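(* Let $V(f)\subset P^3$ be a nonsingular cubic surface over $k$. If $V(f)$ is $(\mathbf{Z}_3)^3$-invariant, i.e. $\mathrm{Aut}(V(f))$ contains a subgroup isomorphic to $(\mathbf{Z}_3)^3$, then $V(f)$ is projectively equivalent to the Fermat cubic surface $V(x^3+y^3+z^3+t^3)$. In particular, if $V(f)$ is $(\mathbf{Z}_3)^3\times_s \mathbf{S}_4$-invariant, i.e. $\mathrm{Aut}(V(f))$ contains a subgroup isomorphic to $(\mathbf{Z}_3)^3\times_s \mathbf{S}_4$, then $V(f)$ is projectively equivalent to $V(x^3+y^3+z^3+t^3)$, and $\mathrm{Aut}(V(f))$ is conjugate in $PGL_4(k)$ to $(D(3))\times_s\mathbf{S}_4$, regarded as the subgroup $D(3)\hat{\mathbf{S}}_4/k^*E_4$ of $PGL_4(k)$.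
   Context: $k$ is an algebraically closed field of characteristic zero, $E_4$ is the $4\times 4$ unit matrix, $PGL_4(k)=GL_4(k)/k^*E_4$, and $(A)$ denotes the class of $A\in GL_4(k)$ in $PGL_4(k)$. For a homogeneous polynomial $f$ in four variables $x,y,z,t$ over $k$, $V(f)\subset P^3$ is its zero set; $V(f)$ is nonsingular if the partial derivatives of $f$ have no common zero on $V(f)$. For $A\in GL_4(k)$, $f_A(v)=f(A^{-1}v)$ for column vectors $v$ of variables, and $f_A\sim f$ means $f_A=\lambda f$ for some $\lambda\in k^*$. For a nonsingular cubic surface $V(f)$ (with $f$ homogeneous of degree 3), $\mathrm{Aut}(V(f))=\{(A)\in PGL_4(k): f_A\sim f\}$. Surfaces $V(f)$ and $V(g)$ are projectively equivalent if $g\sim f_A$ for some $A\in GL_4(k)$. $\mathbf{S}_4$ is the symmetric group on 4 letters. For $\sigma\in\mathbf{S}_4$, $\hat\sigma\in GL_4(k)$ is the permutation matrix with $\hat\sigma v=w$, $w_i=v_{\sigma^{-1}(i)}$, and $\hat{\mathbf{S}}_4=\{\hat\sigma:\sigma\in\mathbf{S}_4\}$. Put $D(3)=\{\mathrm{diag}[\lambda_1,\lambda_2,\lambda_3,\lambda_4]\in GL_4(k): \lambda_1^3=\lambda_2^3=\lambda_3^3=\lambda_4^3\}$ and $(D(3))=D(3)/k^*E_4\cong(\mathbf{Z}_3)^3$. The semidirect product $(D(3))\times_s\mathbf{S}_4$ has multiplication $((A),\sigma)((A'),\sigma')=((A)(\hat\sigma A'\hat\sigma^{-1}),\sigma\sigma')$;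 it is isomorphic to, and identified with, $D(3)\hat{\mathbf{S}}_4/k^*E_4\subset PGL_4(k)$ via $((A),\sigma)\mapsto (A\hat\sigma)$. The abstract group $(\mathbf{Z}_3)^3\times_s\mathbf{S}_4$ means this group up to isomorphism. *)

theory Defs
  imports
    "HOL-Analysis.Analysis"
    "HOL-Algebra.Bij"
    "HOL-Algebra.Elementary_Groups"
    "HOL-Library.Poly_Mapping"
    "HOL-Computational_Algebra.Polynomial"
begin

section \<open>Forms in four variables\<close>

text \<open>The polynomial ring over \<open>'a\<close> in four variables, as the monoid algebra of the exponent
  vectors. The four variables \<open>x, y, z, t\<close> are indexed by \<open>1, 2, 3, 4\<close> of the four-element
  type \<^typ>\<open>4\<close> (in which \<open>4 = 0\<close>), the index type of \<open>'a^4\<close>.\<close>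

type_synonym 'a poly4 = "(4 \<Rightarrow>\<^sub>0 nat) \<Rightarrow>\<^sub>0 'a"

definition Const4 :: "'a::zero \<Rightarrow> 'a poly4" where
  "Const4 c = Poly_Mapping.single 0 c"

definition Var4 :: "4 \<Rightarrow> 'a::zero_neq_one poly4" where
  "Var4 i = Poly_Mapping.single (Poly_Mapping.single i 1) 1"

text \<open>Apply \<open>\<phi>\<close> to the coefficients and replace the \<open>i\<close>-th variable by \<open>s i\<close>.\<close>

definition insertion4 :: "('a::zero \<Rightarrow> 'b::comm_semiring_1) \<Rightarrow> (4 \<Rightarrow> 'b) \<Rightarrow> 'a poly4 \<Rightarrow> 'b" where
  "insertion4 \<phi> s p =
     (\<Sum>m\<in>Poly_Mapping.keys p. \<phi> (Poly_Mapping.lookup p m) * (\<Prod>i\<in>UNIV. s i ^ Poly_Mapping.lookup m i))"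

definition eval4 :: "'a::comm_semiring_1 poly4 \<Rightarrow> 'a^4 \<Rightarrow> 'a" where
  "eval4 p v = insertion4 (\<lambda>c. c) (\<lambda>i. v $ i) p"

definition subst4 :: "(4 \<Rightarrow> 'a::comm_semiring_1 poly4) \<Rightarrow> 'a poly4 \<Rightarrow> 'a poly4" where
  "subst4 s p = insertion4 Const4 s p"

text \<open>The formal partial derivative. The truncated subtraction is harmless: where the exponent of
  the \<open>i\<close>-th variable is 0, the coefficient vanishes.\<close>

definition pderiv4 :: "4 \<Rightarrow> 'a::comm_semiring_1 poly4 \<Rightarrow> 'a poly4" where
  "pderiv4 i p =
     (\<Sum>m\<in>Poly_Mapping.keys p. Poly_Mapping.single (m - Poly_Mapping.single i 1)
        (of_nat (Poly_Mapping.lookup m i) * Poly_Mapping.lookup p m))"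

definition homogeneous4 :: "nat \<Rightarrow> 'a::zero poly4 \<Rightarrow> bool" where
  "homogeneous4 d p \<longleftrightarrow> (\<forall>m\<in>Poly_Mapping.keys p. (\<Sum>i\<in>UNIV. Poly_Mapping.lookup m i) = d)"

text \<open>\<open>V(f)\<close>, where a point of \<open>P\<^sup>3\<close> is given by any of its (nonzero) vectors of homogeneous
  coordinates.\<close>

definition V4 :: "'a::comm_semiring_1 poly4 \<Rightarrow> ('a^4) set" where
  "V4 f = {v. v \<noteq> 0 \<and> eval4 f v = 0}"

definition nonsingular4 :: "'a::comm_semiring_1 poly4 \<Rightarrow> bool" where
  "nonsingular4 f \<longleftrightarrow> \<not> (\<exists>v\<in>V4 f. \<forall>i. eval4 (pderiv4 i f) v = 0)"

text \<open>The zero form is homogeneous of every degree, but it is not nonsingular.\<close>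

definition nonsingular_cubic_surface :: "'a::comm_semiring_1 poly4 \<Rightarrow> bool" where
  "nonsingular_cubic_surface f \<longleftrightarrow> homogeneous4 3 f \<and> nonsingular4 f"

text \<open>\<open>f\<^sub>A(v) = f(A\<^sup>-\<^sup>1 v)\<close> for the column vector \<open>v\<close> of the variables.\<close>

definition act4 :: "'a::comm_semiring_1^4^4 \<Rightarrow> 'a poly4 \<Rightarrow> 'a poly4" where
  "act4 A f = subst4 (\<lambda>i. \<Sum>j\<in>UNIV. Const4 (matrix_inv A $ i $ j) * Var4 j) f"

definition sim4 :: "'a::comm_semiring_1 poly4 \<Rightarrow> 'a poly4 \<Rightarrow> bool" (infix \<open>\<sim>\<^sub>4\<close> 50) where
  "g \<sim>\<^sub>4 f \<longleftrightarrow> (\<exists>c. c \<noteq> 0 \<and> g = Const4 c * f)"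

definition proj_equivalent :: "'a::field poly4 \<Rightarrow> 'a poly4 \<Rightarrow> bool" where
  "proj_equivalent f g \<longleftrightarrow> (\<exists>A. invertible A \<and> g \<sim>\<^sub>4 act4 A f)"

definition fermat_cubic :: "'a::comm_semiring_1 poly4" where
  "fermat_cubic = Var4 1 ^ 3 + Var4 2 ^ 3 + Var4 3 ^ 3 + Var4 4 ^ 3"


section \<open>The projective linear group and automorphism groups\<close>

definition GL4 :: "('a::field^4^4) monoid" where
  "GL4 = \<lparr>carrier = {A. invertible A}, mult = (**), one = mat 1\<rparr>"

definition scalars4 :: "('a::field^4^4) set" where
  "scalars4 = {mat c | c. c \<noteq> 0}"

definition PGL4 :: "('a::field^4^4) set monoid" where
  "PGL4 = GL4 Mod scalars4"

definition pclass :: "'a::field^4^4 \<Rightarrow> ('a^4^4) set" where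
  "pclass A = scalars4 #>\<^bsub>GL4\<^esub> A"

text \<open>For a form \<open>f\<close> the condition does not depend on the representative \<open>A\<close> of its class.\<close>

definition Aut4 :: "'a::field poly4 \<Rightarrow> ('a^4^4) set set" where
  "Aut4 f = {pclass A | A. A \<in> carrier GL4 \<and> act4 A f \<sim>\<^sub>4 f}"

definition group_invariant :: "('b, 'c) monoid_scheme \<Rightarrow> 'a::field poly4 \<Rightarrow> bool" where
  "group_invariant G f \<longleftrightarrow>
     (\<exists>H. subgroup H (PGL4\<lparr>carrier := Aut4 f\<rparr>) \<and> PGL4\<lparr>carrier := H\<rparr> \<cong> G)"

definition conjugate_in :: "('b, 'c) monoid_scheme \<Rightarrow> 'b set \<Rightarrow> 'b set \<Rightarrow> bool" where
  "conjugate_in G H K \<longleftrightarrow>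
     (\<exists>g\<in>carrier G. K = (\<lambda>h. g \<otimes>\<^bsub>G\<^esub> h \<otimes>\<^bsub>G\<^esub> inv\<^bsub>G\<^esub> g) ` H)"


section \<open>The groups \<open>(\<int>\<^sub>3)\<^sup>3\<close> and \<open>(\<int>\<^sub>3)\<^sup>3 \<times>\<^sub>s S\<^sub>4\<close>\<close>

definition Z3_cubed :: "(int \<times> int \<times> int) monoid" where
  "Z3_cubed = integer_mod_group 3 \<times>\<times> integer_mod_group 3 \<times>\<times> integer_mod_group 3"

abbreviation S4 :: "(4 \<Rightarrow> 4) monoid" where
  "S4 \<equiv> BijGroup UNIV"

text \<open>\<open>(perm_mat \<sigma> *v v) $ i = v $ (\<sigma>\<^sup>-\<^sup>1 i)\<close>\<close>

definition perm_mat :: "(4 \<Rightarrow> 4) \<Rightarrow> 'a::field^4^4" where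
  "perm_mat \<sigma> = (\<chi> i j. if j = inv_into UNIV \<sigma> i then 1 else 0)"

definition diag4 :: "(4 \<Rightarrow> 'a::field) \<Rightarrow> 'a^4^4" where
  "diag4 l = (\<chi> i j. if i = j then l i else 0)"

definition D3 :: "('a::field^4^4) set" where
  "D3 = {diag4 l | l. diag4 l \<in> carrier GL4 \<and> l 1 ^ 3 = l 2 ^ 3 \<and> l 2 ^ 3 = l 3 ^ 3 \<and> l 3 ^ 3 = l 4 ^ 3}"

text \<open>The semidirect product \<open>(D(3)) \<times>\<^sub>s S\<^sub>4\<close>, a model of \<open>(\<int>\<^sub>3)\<^sup>3 \<times>\<^sub>s S\<^sub>4\<close>.\<close>

definition D3_semidirect_S4 :: "(('a::field^4^4) set \<times> (4 \<Rightarrow> 4)) monoid" where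
  "D3_semidirect_S4 =
     \<lparr>carrier = pclass ` D3 \<times> carrier S4,
      mult = (\<lambda>(a, \<sigma>) (a', \<sigma>').
        (a \<otimes>\<^bsub>PGL4\<^esub> (pclass (perm_mat \<sigma>) \<otimes>\<^bsub>PGL4\<^esub> a' \<otimes>\<^bsub>PGL4\<^esub> inv\<^bsub>PGL4\<^esub> pclass (perm_mat \<sigma>)),
         \<sigma> \<otimes>\<^bsub>S4\<^esub> \<sigma>')),
      one = (\<one>\<^bsub>PGL4\<^esub>, \<one>\<^bsub>S4\<^esub>)\<rparr>"

text \<open>Its image in \<open>PGL\<^sub>4\<close> under \<open>((A), \<sigma>) \<mapsto> (A ** perm_mat \<sigma>)\<close>.\<close>

definition D3_S4_in_PGL4 :: "('a::field^4^4) set set" where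
  "D3_S4_in_PGL4 = {pclass (A ** perm_mat \<sigma>) | A \<sigma>. A \<in> D3 \<and> \<sigma> \<in> carrier S4}"

end

(*
  If the classes of two lifts A, B of automorphisms commute, then AB = c BA. Invariance of the cubic
  form gives c^3 = 1 and the determinant gives c^4 = 1, so AB = BA. Hence lifts of (Z_3)^3 with cube 1
  are simultaneously diagonalizable, with cube roots of unity on the diagonal. Modulo scalars there are
  only 27 such diagonal matrices, so in suitable coordinates all of them act on the surface. Then all
  monomials of the form have the same exponents modulo 3, and nonsingularity at the coordinate points
  leaves only the pure cubes. The automorphisms of the Fermat cubic are found by polarizing the
  identity f(Bv) = c f(v).
*)
theory Submission
  imports Defs
begin

section \<open>Forms as functions\<close>

text \<open>A change of coordinates is easy to follow on values and awkward on coefficients.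
  Therefore forms are handled through \<open>eval4\<close>, which loses nothing over an infinite
  field (\<open>eval4_inject\<close>). Nonsingularity is restated for values too: through each point
  there is a line that meets the surface there with multiplicity at most one. Coefficients return
  when monomials have to be told apart.

  That commuting classes have commuting lifts rests on the coprimality of the degree 3 and the
  number 4 of variables. For plane cubics it fails: the Heisenberg group of order 27 acts on the
  Hesse pencil, and its image (Z_3)^2 has no commuting lift.

  The assumed group enters only through 27 commuting classes with trivial cubes. So one argument
  serves both groups of the theorem, and no isomorphism between \<open>Z3_cubed\<close> and the
  classes of \<open>D3\<close> has to be exhibited.\<close>

definition mono4 :: "(4 \<Rightarrow>\<^sub>0 nat) \<Rightarrow> 'a::comm_semiring_1^4 \<Rightarrow> 'a" where
  "mono4 m v = (\<Prod>i\<in>UNIV. v $ i ^ Poly_Mapping.lookup m i)"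

lemma eval4_eq_sum:
  assumes "finite S" "Poly_Mapping.keys p \<subseteq> S"
  shows "eval4 p v = (\<Sum>m\<in>S. Poly_Mapping.lookup p m * mono4 m v)"
  unfolding eval4_def insertion4_def mono4_def
  by (rule sum.mono_neutral_left) (use assms in \<open>auto simp: in_keys_iff\<close>)

lemmas eval4_keys = eval4_eq_sum[OF finite_keys order_refl]

lemma eval4_single: "eval4 (Poly_Mapping.single m a) v = a * mono4 m v"
  by (subst eval4_eq_sum[of "{m}"]) auto

lemma eval4_0 [simp]: "eval4 0 v = 0"
  by (simp add: eval4_keys)

lemma eval4_add [simp]: "eval4 (p + q) v = eval4 p v + eval4 q v"
proof -
  have "Poly_Mapping.keys (p + q) \<subseteq> Poly_Mapping.keys p \<union> Poly_Mapping.keys q"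
    by (rule Poly_Mapping.keys_add)
  then show ?thesis
    by (subst (1 2 3) eval4_eq_sum[of "Poly_Mapping.keys p \<union> Poly_Mapping.keys q"])
       (auto simp: lookup_add distrib_right sum.distrib)
qed

lemma eval4_sum [simp]: "eval4 (sum g A) v = (\<Sum>x\<in>A. eval4 (g x) v)"
  by (induction A rule: infinite_finite_induct) auto

lemma poly_mapping_sum_single:
  "(\<Sum>m\<in>Poly_Mapping.keys p. Poly_Mapping.single m (Poly_Mapping.lookup p m)) = p"
  by (rule poly_mapping_eqI)
     (auto simp: lookup_sum lookup_single when_def sum.delta in_keys_iff)

lemma mono4_add: "mono4 (m + n) v = mono4 m v * mono4 n v"
  by (simp add: mono4_def lookup_add power_add prod.distrib)

lemma eval4_mult [simp]: "eval4 (p * q) v = eval4 p v * eval4 q v"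
proof -
  let ?s = "\<lambda>p m. Poly_Mapping.single m (Poly_Mapping.lookup p m)"
  have "eval4 (p * q) v = eval4 ((\<Sum>m\<in>Poly_Mapping.keys p. ?s p m) * (\<Sum>n\<in>Poly_Mapping.keys q. ?s q n)) v"
    by (simp add: poly_mapping_sum_single)
  also have "\<dots> = (\<Sum>m\<in>Poly_Mapping.keys p. \<Sum>n\<in>Poly_Mapping.keys q. eval4 (?s p m * ?s q n) v)"
    by (simp add: sum_product)
  also have "\<dots> = (\<Sum>m\<in>Poly_Mapping.keys p. \<Sum>n\<in>Poly_Mapping.keys q. eval4 (?s p m) v * eval4 (?s q n) v)"
    by (simp add: mult_single eval4_single mono4_add mult_ac)
  also have "\<dots> = eval4 (\<Sum>m\<in>Poly_Mapping.keys p. ?s p m) v * eval4 (\<Sum>n\<in>Poly_Mapping.keys q. ?s q n) v"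
    by (simp add: sum_product)
  finally show ?thesis by (simp add: poly_mapping_sum_single)
qed

lemma eval4_Const4 [simp]: "eval4 (Const4 c) v = c"
  by (simp add: Const4_def eval4_single mono4_def)

lemma eval4_1 [simp]: "eval4 1 v = 1"
  using eval4_Const4[of 1 v] by (simp add: Const4_def)

lemma mono4_single: "mono4 (Poly_Mapping.single i n) v = v $ i ^ n"
  by (simp add: mono4_def lookup_single when_def if_distrib prod.delta cong: if_cong)

lemma eval4_Var4 [simp]: "eval4 (Var4 i) v = v $ i"
  by (simp add: Var4_def eval4_single mono4_single)

lemma eval4_power [simp]: "eval4 (p ^ n) v = eval4 p v ^ n"
  by (induction n) auto

lemma eval4_prod [simp]: "eval4 (prod g A) v = (\<Prod>x\<in>A. eval4 (g x) v)"
  by (induction A rule: infinite_finite_induct) auto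

lemma eval4_subst4: "eval4 (subst4 s p) v = eval4 p (\<chi> i. eval4 (s i) v)"
  unfolding subst4_def eval4_keys[of p] insertion4_def by (simp add: mono4_def)

lemma eval4_act4: "eval4 (act4 A p) v = eval4 p (matrix_inv A *v v)"
  by (simp add: act4_def eval4_subst4 matrix_vector_mult_def)

lemma eval4_fermat: "eval4 fermat_cubic v = (\<Sum>i\<in>UNIV. v $ i ^ 3)"
  by (simp add: fermat_cubic_def sum_4)

section \<open>Forms are determined by their values\<close>

lemma base_repr_unique:
  fixes a b x y N :: nat
  assumes "a < N" "b < N" "a + N * x = b + N * y"
  shows "a = b \<and> x = y"
proof -
  have "(a + N * x) mod N = (b + N * y) mod N" "(a + N * x) div N = (b + N * y) div N"
    using assms(3) by simp_all
  then show ?thesis using assms(1,2) by simp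
qed

text \<open>Kronecker substitution: \<open>v\<^sub>i = t^N^i\<close> turns distinct monomials into distinct powers of \<open>t\<close>.\<close>

lemma eval4_eq_0D:
  fixes p :: "'a::{idom, ring_char_0} poly4"
  assumes z: "\<And>v. eval4 p v = 0"
  shows "p = 0"
proof (rule poly_mapping_eqI)
  fix m0
  let ?l = "Poly_Mapping.lookup"
  \<comment> \<open>\<open>N\<close> exceeds every exponent that occurs; the inserted 0 keeps
    \<open>Max\<close> defined when \<open>p\<close> is zero.\<close>
  define N where "N = Suc (Max (insert 0 ((\<lambda>(m, i). ?l m i) ` (Poly_Mapping.keys p \<times> UNIV))))"
  have N: "?l m i < N" if "m \<in> Poly_Mapping.keys p" for m i
  proof -
    have "?l m i \<le> Max (insert 0 ((\<lambda>(m, i). ?l m i) ` (Poly_Mapping.keys p \<times> UNIV)))"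
      using that by (intro Max_ge) force+
    then show ?thesis unfolding N_def by simp
  qed
  define e where "e m = ?l m 1 + N * (?l m 2 + N * (?l m 3 + N * ?l m 4))" for m :: "4 \<Rightarrow>\<^sub>0 nat"
  have inj: "m = n" if "m \<in> Poly_Mapping.keys p" "n \<in> Poly_Mapping.keys p" "e m = e n" for m n
  proof (rule poly_mapping_eqI)
    \<comment> \<open>Division by \<open>N\<close> reads off the exponents from \<open>e m\<close>,
      one base \<open>N\<close> digit at a time.\<close>
    note b = base_repr_unique[of _ N]
    have 1: "?l m 1 = ?l n 1 \<and> ?l m 2 + N * (?l m 3 + N * ?l m 4) = ?l n 2 + N * (?l n 3 + N * ?l n 4)"
      using b[OF N[OF that(1)] N[OF that(2)]] that(3) unfolding e_def by blast
    have 2: "?l m 2 = ?l n 2 \<and> ?l m 3 + N * ?l m 4 = ?l n 3 + N * ?l n 4"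
      using b[OF N[OF that(1)] N[OF that(2)]] 1 by blast
    have 3: "?l m 3 = ?l n 3 \<and> ?l m 4 = ?l n 4"
      using b[OF N[OF that(1)] N[OF that(2)]] 2 by blast
    show "?l m i = ?l n i" for i
      using 1 2 3 exhaust_4[of i] by auto
  qed
  define q where "q = (\<Sum>m\<in>Poly_Mapping.keys p. monom (?l p m) (e m))"
  \<comment> \<open>The weights N^0, ..., N^3 of the variables 1, ..., 4 match the digit positions
    in \<open>e\<close>.\<close>
  define k :: "4 \<Rightarrow> nat" where "k i = (if i = 1 then 1 else if i = 2 then N else if i = 3 then N * N else N * N * N)" for i
  have "poly q t = 0" for t
  proof -
    have "mono4 m (\<chi> i. t ^ k i) = t ^ e m" for m
    proof -
      have "mono4 m (\<chi> i. t ^ k i) = (\<Prod>i\<in>UNIV. t ^ (k i * ?l m i))"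
        by (simp add: mono4_def power_mult)
      also have "\<dots> = t ^ (\<Sum>i\<in>UNIV. k i * ?l m i)"
        by (simp add: power_sum)
      also have "(\<Sum>i\<in>UNIV. k i * ?l m i) = e m"
        by (simp add: sum_4 k_def e_def algebra_simps)
      finally show ?thesis .
    qed
    then have "poly q t = eval4 p (\<chi> i. t ^ k i)"
      by (simp add: q_def poly_sum poly_monom eval4_keys)
    then show ?thesis using z by simp
  qed
  then have q0: "q = 0" by (simp add: poly_all_0_iff_0[symmetric])
  show "?l p m0 = ?l 0 m0"
  proof (cases "m0 \<in> Poly_Mapping.keys p")
    case True
    have "0 = coeff q (e m0)" by (simp add: q0)
    also have "\<dots> = (\<Sum>m\<in>Poly_Mapping.keys p. if m = m0 then ?l p m else 0)"
      unfolding q_def coeff_sum by (rule sum.cong) (use inj True in auto)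
    also have "\<dots> = ?l p m0" using True by simp
    finally show ?thesis by simp
  qed (simp add: in_keys_iff)
qed

lemma eval4_inject:
  fixes p q :: "'a::{idom, ring_char_0} poly4"
  assumes "\<And>v. eval4 p v = eval4 q v"
  shows "p = q"
proof -
  have "eval4 (p - q) v = 0" for v
    using eval4_add[of "p - q" q v] assms[of v] by simp
  then show ?thesis using eval4_eq_0D[of "p - q"] by simp
qed

lemma sim4_iff_eval4:
  fixes f g :: "'a::{idom, ring_char_0} poly4"
  shows "g \<sim>\<^sub>4 f \<longleftrightarrow> (\<exists>c. c \<noteq> 0 \<and> (\<forall>v. eval4 g v = c * eval4 f v))"
  unfolding sim4_def by (metis eval4_inject eval4_mult eval4_Const4)

text \<open>Each monomial is an eigenvector of a diagonal substitution, so comparing coefficients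
  forces every monomial that occurs in \<open>g\<close> to have the eigenvalue
  \<open>c\<close>.\<close>

lemma lookup_diagonal_semi_invariant:
  fixes g :: "'a::{idom, ring_char_0} poly4"
  assumes "\<And>v. eval4 g (\<chi> i. d i * v $ i) = c * eval4 g v"
  shows "Poly_Mapping.lookup g m * (\<Prod>i\<in>UNIV. d i ^ Poly_Mapping.lookup m i) = c * Poly_Mapping.lookup g m"
proof -
  let ?e = "\<lambda>m. \<Prod>i\<in>UNIV. d i ^ Poly_Mapping.lookup m i"
  define h where "h = (\<Sum>m\<in>Poly_Mapping.keys g. Poly_Mapping.single m (Poly_Mapping.lookup g m * ?e m))"
  have "eval4 h v = eval4 (Const4 c * g) v" for v
  proof -
    have "eval4 h v = eval4 g (\<chi> i. d i * v $ i)"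
      by (simp add: h_def eval4_single eval4_keys[of g] mono4_def power_mult_distrib prod.distrib mult_ac)
    then show ?thesis using assms by simp
  qed
  then have "h = Const4 c * g" by (rule eval4_inject)
  also have "Poly_Mapping.lookup \<dots> m = c * Poly_Mapping.lookup g m"
    by (simp add: Const4_def mult_map_scale_conv_mult[symmetric] Poly_Mapping.map.rep_eq when_def)
  finally have "Poly_Mapping.lookup h m = c * Poly_Mapping.lookup g m" by simp
  moreover have "Poly_Mapping.lookup h m = Poly_Mapping.lookup g m * ?e m"
    by (auto simp: h_def lookup_sum lookup_single when_def sum.delta in_keys_iff)
  ultimately show ?thesis by simp
qed

lemma homogeneous4_iff_eval4:
  fixes g :: "'a::{idom, ring_char_0} poly4"
  shows "homogeneous4 n g \<longleftrightarrow> (\<forall>c v. eval4 g (c *s v) = c ^ n * eval4 g v)"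
proof
  assume h: "homogeneous4 n g"
  show "\<forall>(c::'a) v. eval4 g (c *s v) = c ^ n * eval4 g v"
  proof (intro allI)
    fix c :: 'a and v
    have "mono4 m (c *s v) = c ^ n * mono4 m v" if "m \<in> Poly_Mapping.keys g" for m
      using h that unfolding homogeneous4_def mono4_def
      by (simp add: power_mult_distrib prod.distrib power_sum[symmetric])
    then show "eval4 g (c *s v) = c ^ n * eval4 g v"
      by (simp add: eval4_keys sum_distrib_left mult_ac)
  qed
next
  assume h: "\<forall>c v. eval4 g (c *s v) = c ^ n * eval4 g v"
  show "homogeneous4 n g"
    unfolding homogeneous4_def
  proof
    fix m assume m: "m \<in> Poly_Mapping.keys g"
    \<comment> \<open>Scaling by 2 alone detects the degree, because the powers of 2 are distinct in
      characteristic zero.\<close>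
    have "Poly_Mapping.lookup g m * (\<Prod>i\<in>UNIV. 2 ^ Poly_Mapping.lookup m i) = 2 ^ n * Poly_Mapping.lookup g m"
    proof (rule lookup_diagonal_semi_invariant)
      fix v :: "'a^4"
      show "eval4 g (\<chi> i. 2 * v $ i) = 2 ^ n * eval4 g v"
        using h by (simp add: vector_scalar_mult_def)
    qed
    then have "(2::'a) ^ (\<Sum>i\<in>UNIV. Poly_Mapping.lookup m i) = 2 ^ n"
      using m by (simp add: power_sum in_keys_iff)
    then have "of_nat (2 ^ (\<Sum>i\<in>UNIV. Poly_Mapping.lookup m i)) = (of_nat (2 ^ n) :: 'a)"
      by simp
    then have "(2::nat) ^ (\<Sum>i\<in>UNIV. Poly_Mapping.lookup m i) = 2 ^ n"
      unfolding of_nat_eq_iff .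
    then show "(\<Sum>i\<in>UNIV. Poly_Mapping.lookup m i) = n" by simp
  qed
qed

section \<open>First-order expansion along lines\<close>

lemma power_add_expand:
  fixes a :: "'a::comm_ring_1"
  shows "\<exists>q. \<forall>s. (a + s) ^ n = a ^ n + of_nat n * a ^ (n - 1) * s + s ^ 2 * poly q s"
proof (induction n)
  case 0
  show ?case by (rule exI[of _ 0]) simp
next
  case (Suc n)
  then obtain q where q: "\<And>s. (a + s) ^ n = a ^ n + of_nat n * a ^ (n - 1) * s + s ^ 2 * poly q s"
    by blast
  \<comment> \<open>For \<open>n = 0\<close> the factor \<open>of_nat n\<close> vanishes, so the
    truncated exponent \<open>n - 1\<close> does no harm.\<close>
  have n: "of_nat n * a ^ n = a * (of_nat n * a ^ (n - 1))"
    by (cases n) (auto simp: algebra_simps)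
  show ?case
  proof (intro exI allI)
    fix s
    have "(a + s) ^ Suc n = (a + s) * (a ^ n + of_nat n * a ^ (n - 1) * s + s ^ 2 * poly q s)"
      by (simp add: q)
    also have "\<dots> = a ^ Suc n + of_nat (Suc n) * a ^ (Suc n - 1) * s
       + s ^ 2 * poly ([:of_nat n * a ^ (n - 1):] + [:a, 1:] * q) s"
      using n by (simp add: algebra_simps power2_eq_square)
    finally show "(a + s) ^ Suc n = a ^ Suc n + of_nat (Suc n) * a ^ (Suc n - 1) * s
       + s ^ 2 * poly ([:of_nat n * a ^ (n - 1):] + [:a, 1:] * q) s" .
  qed
qed

text \<open>This is the only link between formal derivatives and values. The remainder must be a
  polynomial in \<open>s\<close>: for an arbitrary function, divisibility by \<open>s ^ 2\<close>
  would say no more than vanishing at 0.\<close>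

lemma eval4_pderiv4_expand:
  fixes p :: "'a::comm_ring_1 poly4"
  shows "\<exists>q. \<forall>s. eval4 p (v + s *s axis i 1) = eval4 p v + s * eval4 (pderiv4 i p) v + s ^ 2 * poly q s"
proof -
  let ?l = "Poly_Mapping.lookup"
  let ?dm = "\<lambda>m. of_nat (?l m i) * mono4 (m - Poly_Mapping.single i 1) v"
  have 1: "\<exists>q. \<forall>s. mono4 m (v + s *s axis i 1) = mono4 m v + s * ?dm m + s ^ 2 * poly q s" for m
  proof -
    \<comment> \<open>The factor of the monomial that is constant along the direction of the
      \<open>i\<close>-th axis.\<close>
    define R where "R = (\<Prod>j\<in>UNIV - {i}. v $ j ^ ?l m j)"
    obtain q where q: "\<And>s. (v $ i + s) ^ ?l m i = v $ i ^ ?l m i + of_nat (?l m i) * v $ i ^ (?l m i - 1) * s + s ^ 2 * poly q s"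
      using power_add_expand by blast
    have a: "mono4 m (v + s *s axis i 1) = (v $ i + s) ^ ?l m i * R" for s
      unfolding mono4_def R_def by (subst prod.remove[of _ i]) (auto simp: axis_def intro!: prod.cong)
    have b: "mono4 m v = v $ i ^ ?l m i * R"
      unfolding mono4_def R_def by (subst prod.remove[of _ i]) auto
    have c: "mono4 (m - Poly_Mapping.single i 1) v = v $ i ^ (?l m i - 1) * R"
      unfolding mono4_def R_def
      by (subst prod.remove[of _ i]) (auto simp: lookup_minus lookup_single when_def intro!: prod.cong)
    show ?thesis
      by (rule exI[of _ "[:R:] * q"]) (simp only: a b c q, simp add: algebra_simps)
  qed
  then obtain q where q: "\<And>m s. mono4 m (v + s *s axis i 1) = mono4 m v + s * ?dm m + s ^ 2 * poly (q m) s"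
    by metis
  have "eval4 (pderiv4 i p) v = (\<Sum>m\<in>Poly_Mapping.keys p. ?l p m * ?dm m)"
    by (simp add: pderiv4_def eval4_single algebra_simps)
  then have "eval4 p (v + s *s axis i 1) = eval4 p v + s * eval4 (pderiv4 i p) v
      + s ^ 2 * poly (\<Sum>m\<in>Poly_Mapping.keys p. [:?l p m:] * q m) s" for s
    by (simp add: eval4_keys[of p] q poly_sum sum_distrib_left sum.distrib algebra_simps)
  then show ?thesis by blast
qed

text \<open>A coordinate-free way to detect singular points, which replaces the chain rule for
  \<open>pderiv4\<close> under a change of coordinates.\<close>

lemma nonsingular4_no_double_zero:
  fixes f :: "'a::{idom, ring_char_0} poly4"
  assumes "nonsingular4 f" "v \<noteq> 0"
  shows "\<exists>w. \<not> (\<exists>q. \<forall>s. eval4 f (v + s *s w) = s ^ 2 * poly q s)"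
proof (rule ccontr)
  assume "\<not> ?thesis"
  then have *: "\<exists>q. \<forall>s. eval4 f (v + s *s w) = s ^ 2 * poly q s" for w by blast
  have v0: "eval4 f v = 0"
  proof -
    obtain q where "\<forall>s. eval4 f (v + s *s 0) = s ^ 2 * poly q s" using * by blast
    from spec[OF this, of 0] show ?thesis by simp
  qed
  have "eval4 (pderiv4 i f) v = 0" for i
  proof -
    obtain q where q: "\<And>s. eval4 f (v + s *s axis i 1) = s ^ 2 * poly q s" using * by blast
    obtain r where r: "\<And>s. eval4 f (v + s *s axis i 1) = eval4 f v + s * eval4 (pderiv4 i f) v + s ^ 2 * poly r s"
      using eval4_pderiv4_expand by blast
    \<comment> \<open>Both expansions hold for all \<open>s\<close>, so their difference is the zero
      polynomial; its linear coefficient is the derivative.\<close>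
    have "poly ([:0, eval4 (pderiv4 i f) v:] + monom 1 2 * (r - q)) s = 0" for s
      using q[of s] r[of s] v0 by (simp add: poly_monom algebra_simps)
    then have "[:0, eval4 (pderiv4 i f) v:] + monom 1 2 * (r - q) = 0"
      using poly_all_0_iff_0 by blast
    then have "coeff ([:0, eval4 (pderiv4 i f) v:] + monom 1 2 * (r - q)) 1 = 0"
      by simp
    then show ?thesis by (simp add: coeff_monom_mult)
  qed
  then show False using assms v0 unfolding nonsingular4_def V4_def by blast
qed

section \<open>Matrices and the projective linear group\<close>

lemma if_zero_mult: "(if b then c else 0) * x = (if b then c * x else (0 :: 'a::mult_zero))"
  by simp

lemma mat_mult_nth [simp]: "(mat c ** A) $ i $ j = (c :: 'a::comm_semiring_1) * A $ i $ j"
  by (simp add: matrix_matrix_mult_def mat_def if_zero_mult)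

lemma mat_mult_commute: "A ** mat c = mat c ** (A :: 'a::comm_semiring_1^'n^'n)"
  by (simp add: vec_eq_iff matrix_matrix_mult_def mat_def if_distrib if_distribR mult.commute cong: if_cong)

lemma mat_mult_mat [simp]: "mat c ** mat d = (mat (c * d) :: 'a::comm_semiring_1^'n^'n)"
  unfolding vec_eq_iff mat_mult_nth by (simp add: mat_def)

lemma mat_mult_vec [simp]: "mat c *v v = (c :: 'a::comm_semiring_1) *s v"
  by (simp add: vec_eq_iff matrix_vector_mult_def mat_def if_zero_mult)

lemma mat_mult_mult: "(mat a ** (A :: 'a^'n^'n)) ** (mat b ** B) = mat (a * b) ** (A ** (B :: 'a::comm_semiring_1^'n^'n))"
proof -
  have "(mat a ** A) ** (mat b ** B) = mat a ** (A ** mat b) ** B"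
    by (simp only: matrix_mul_assoc)
  also have "\<dots> = (mat a ** mat b) ** (A ** B)"
    by (simp only: mat_mult_commute[of A] matrix_mul_assoc)
  finally show ?thesis by simp
qed

lemma det_mat: "det (mat c :: 'a::comm_ring_1^'n^'n) = c ^ CARD('n)"
  by (subst det_diagonal) (auto simp: mat_def)

lemma invertible_mat: "(c :: 'a::field) \<noteq> 0 \<Longrightarrow> invertible (mat c :: 'a^'n^'n)"
  unfolding invertible_def by (rule exI[of _ "mat (1 / c)"]) simp

lemma
  assumes "invertible A"
  shows matrix_inv_right: "A ** matrix_inv A = mat 1"
    and matrix_inv_left: "matrix_inv A ** A = mat 1"
  using someI_ex[OF assms[unfolded invertible_def]] by (auto simp: matrix_inv_def)

lemma invertible_matrix_inv: "invertible A \<Longrightarrow> invertible (matrix_inv A)"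
  by (metis invertible_def matrix_inv_left matrix_inv_right)

lemma matrix_inv_unique:
  fixes A :: "'a::semiring_1^'n^'n"
  assumes "B ** A = mat 1" "A ** C = mat 1"
  shows "B = C"
proof -
  have "B = B ** (A ** C)" by (simp add: assms)
  also have "\<dots> = (B ** A) ** C" by (simp only: matrix_mul_assoc)
  finally show ?thesis by (simp add: assms)
qed

lemma matrix_inv_matrix_inv:
  assumes "invertible (A :: 'a::semiring_1^'n^'n)"
  shows "matrix_inv (matrix_inv A) = A"
  by (rule matrix_inv_unique[of _ "matrix_inv A"])
     (simp_all add: assms invertible_matrix_inv matrix_inv_left)

lemma
  fixes A :: "'a::comm_semiring_1^'n^'n"
  assumes "invertible A"
  shows matrix_inv_vec_right: "A *v (matrix_inv A *v v) = v"
    and matrix_inv_vec_left: "matrix_inv A *v (A *v v) = v"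
  by (simp_all add: matrix_vector_mul_assoc matrix_inv_left matrix_inv_right assms)

lemma group_GL4: "group (GL4 :: ('a::field^4^4) monoid)"
proof (rule groupI)
  fix A :: "'a^4^4" assume "A \<in> carrier GL4"
  then show "\<exists>B\<in>carrier GL4. B \<otimes>\<^bsub>GL4\<^esub> A = \<one>\<^bsub>GL4\<^esub>"
    by (auto simp: GL4_def intro!: bexI[of _ "matrix_inv A"] invertible_matrix_inv matrix_inv_left)
next
  show "\<one>\<^bsub>GL4\<^esub> \<in> carrier (GL4 :: ('a^4^4) monoid)"
    using invertible_mat[of "1::'a"] by (simp add: GL4_def)
qed (auto simp: GL4_def invertible_mult matrix_mul_assoc)

text \<open>Scalar matrices are central, so left and right cosets agree.\<close>

lemma scalars4_normal: "scalars4 \<lhd> (GL4 :: ('a::field^4^4) monoid)"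
proof -
  interpret group "GL4 :: ('a^4^4) monoid" by (rule group_GL4)
  have inv: "inv\<^bsub>GL4\<^esub> (mat c) = mat (1 / c)" if "c \<noteq> 0" for c :: 'a
    using that by (intro inv_equality) (auto simp: GL4_def invertible_mat)
  have sub: "subgroup (scalars4 :: ('a^4^4) set) GL4"
  proof
    show "(scalars4 :: ('a^4^4) set) \<subseteq> carrier GL4"
      by (auto simp: scalars4_def GL4_def invertible_mat)
    show "\<one>\<^bsub>GL4\<^esub> \<in> (scalars4 :: ('a^4^4) set)"
      unfolding scalars4_def GL4_def by force
  next
    fix x y :: "'a^4^4" assume "x \<in> scalars4" "y \<in> scalars4"
    then show "x \<otimes>\<^bsub>GL4\<^esub> y \<in> scalars4"
      unfolding scalars4_def GL4_def by (force simp del: mult_eq_0_iff simp: no_zero_divisors)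
  next
    fix x :: "'a^4^4" assume "x \<in> scalars4"
    then obtain c where "c \<noteq> 0" "x = mat c" by (auto simp: scalars4_def)
    then show "inv\<^bsub>GL4\<^esub> x \<in> scalars4"
      using inv by (auto simp: scalars4_def)
  qed
  show ?thesis
  proof (rule normalI[OF sub], rule ballI)
    fix x :: "'a^4^4"
    show "scalars4 #>\<^bsub>GL4\<^esub> x = x <#\<^bsub>GL4\<^esub> scalars4"
      by (auto simp: r_coset_def l_coset_def scalars4_def GL4_def mat_mult_commute[of x])
  qed
qed

lemma group_PGL4: "group PGL4"
  unfolding PGL4_def by (rule normal.factorgroup_is_group[OF scalars4_normal])

lemma pclass_eq: "pclass A = {mat c ** A | c. c \<noteq> 0}"
  by (auto simp: pclass_def r_coset_def scalars4_def GL4_def)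

lemma pclass_eq_iff: "pclass A = pclass B \<longleftrightarrow> (\<exists>c. c \<noteq> 0 \<and> B = mat c ** A)"
proof
  assume "pclass A = pclass B"
  moreover have "B \<in> pclass B"
    unfolding pclass_eq by (auto intro!: exI[of _ 1])
  ultimately show "\<exists>c. c \<noteq> 0 \<and> B = mat c ** A"
    unfolding pclass_eq by auto
next
  assume "\<exists>c. c \<noteq> 0 \<and> B = mat c ** A"
  then obtain c where c: "c \<noteq> 0" "B = mat c ** A" by blast
  have "mat d ** A = mat (d / c) ** B" "mat d ** B = mat (d * c) ** A" for d
    using c by (simp_all add: matrix_mul_assoc)
  with c(1) show "pclass A = pclass B"
    unfolding pclass_eq by (metis (no_types, opaque_lifting) divide_eq_0_iff mult_eq_0_iff)
qed

lemma pclass_mult: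
  "invertible A \<Longrightarrow> invertible B \<Longrightarrow> pclass A \<otimes>\<^bsub>PGL4\<^esub> pclass B = pclass (A ** B)"
  using normal.rcos_sum[OF scalars4_normal, of A B]
  by (simp add: pclass_def PGL4_def FactGroup_def GL4_def)

lemma carrier_PGL4: "carrier PGL4 = pclass ` {A. invertible A}"
  by (auto simp: PGL4_def FactGroup_def RCOSETS_def pclass_def GL4_def)

lemma pclass_one: "\<one>\<^bsub>PGL4\<^esub> = pclass (mat 1)"
  by (auto simp: PGL4_def FactGroup_def pclass_eq scalars4_def)

lemma pclass_inv:
  assumes "invertible A"
  shows "inv\<^bsub>PGL4\<^esub> pclass A = pclass (matrix_inv A)"
  by (rule group.inv_equality[OF group_PGL4])
     (use assms in \<open>auto simp: carrier_PGL4 pclass_mult pclass_one invertible_matrix_inv matrix_inv_left\<close>)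

text \<open>The inverse in \<open>act4\<close> is avoided by evaluating at \<open>A *v v\<close>.
  Replacing \<open>v\<close> by its image under \<open>A\<close> or its inverse passes between the
  two conditions and inverts the factor \<open>c\<close>.\<close>

definition semi_invariant4 :: "'a::field poly4 \<Rightarrow> 'a^4^4 \<Rightarrow> bool" where
  "semi_invariant4 f A \<longleftrightarrow> (\<exists>c. c \<noteq> 0 \<and> (\<forall>v. eval4 f (A *v v) = c * eval4 f v))"

lemma act4_sim4_iff:
  fixes f :: "'a::field_char_0 poly4"
  assumes "invertible A"
  shows "act4 A f \<sim>\<^sub>4 f \<longleftrightarrow> semi_invariant4 f A"
proof
  assume "act4 A f \<sim>\<^sub>4 f"
  then obtain c where c: "c \<noteq> 0" "\<And>v. eval4 f (matrix_inv A *v v) = c * eval4 f v"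
    unfolding sim4_iff_eval4 eval4_act4 by blast
  have "eval4 f (A *v v) = (1 / c) * eval4 f v" for v
    using c(1) c(2)[of "A *v v"] assms by (simp add: matrix_inv_vec_left)
  then show "semi_invariant4 f A"
    unfolding semi_invariant4_def using c(1) by (intro exI[of _ "1 / c"]) auto
next
  assume "semi_invariant4 f A"
  then obtain c where c: "c \<noteq> 0" "\<And>v. eval4 f (A *v v) = c * eval4 f v"
    unfolding semi_invariant4_def by blast
  have "eval4 f (matrix_inv A *v v) = (1 / c) * eval4 f v" for v
    using c(1) c(2)[of "matrix_inv A *v v"] assms by (simp add: matrix_inv_vec_right)
  then show "act4 A f \<sim>\<^sub>4 f"
    unfolding sim4_iff_eval4 eval4_act4 using c(1) by (intro exI[of _ "1 / c"]) auto
qed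

lemma Aut4_eq:
  fixes f :: "'a::field_char_0 poly4"
  shows "Aut4 f = {pclass A | A. invertible A \<and> semi_invariant4 f A}"
  unfolding Aut4_def GL4_def by (auto simp: act4_sim4_iff)

lemma proj_equivalentI:
  fixes f g :: "'a::field_char_0 poly4"
  assumes "invertible P" "\<And>v. eval4 g v = eval4 f (P *v v)"
  shows "proj_equivalent f g"
  unfolding proj_equivalent_def sim4_iff_eval4 eval4_act4
  \<comment> \<open>\<open>act4\<close> inverts its matrix, hence the inverse of \<open>P\<close> as
    witness.\<close>
  using assms by (intro exI[of _ "matrix_inv P"] conjI exI[of _ 1])
    (auto simp: invertible_matrix_inv matrix_inv_matrix_inv)

section \<open>Diagonal matrices\<close>

lemma diag4_mult_vec: "diag4 d *v v = (\<chi> i. d i * v $ i)"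
  by (simp add: vec_eq_iff matrix_vector_mult_def diag4_def if_zero_mult)

lemma diag4_mult: "diag4 d ** diag4 e = diag4 (\<lambda>i. d i * e i)"
  by (simp add: vec_eq_iff matrix_matrix_mult_def diag4_def if_zero_mult)

lemma mat_mult_diag4: "mat c ** diag4 d = diag4 (\<lambda>i. c * d i)"
  unfolding vec_eq_iff mat_mult_nth by (simp add: diag4_def)

lemma diag4_one: "diag4 (\<lambda>_. 1) = mat 1"
  by (simp add: vec_eq_iff diag4_def mat_def)

lemma diag4_eq_iff: "diag4 d = diag4 e \<longleftrightarrow> d = e"
proof
  assume "diag4 d = diag4 e"
  then have "diag4 d $ i $ i = diag4 e $ i $ i" for i by simp
  then show "d = e" by (auto simp: diag4_def)
qed simp

lemma invertible_diag4: "invertible (diag4 d) \<longleftrightarrow> (\<forall>i. d i \<noteq> 0)"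
proof -
  have "det (diag4 d) = (\<Prod>i\<in>UNIV. d i)"
    by (subst det_diagonal) (auto simp: diag4_def)
  then show ?thesis by (simp add: invertible_det_nz)
qed

section \<open>Simultaneous diagonalization\<close>

text \<open>A root of 1 + x + x^2 is a cube root of unity, and it differs from 1 because 3 is
  nonzero in characteristic zero.\<close>

lemma primitive_cube_root:
  obtains \<omega> :: "'a::{alg_closed_field, field_char_0}" where "\<omega> \<noteq> 1" "\<omega> ^ 3 = 1" "1 + \<omega> + \<omega> ^ 2 = 0"
    "{z. z ^ 3 = 1} = {1, \<omega>, \<omega> ^ 2}" "\<omega> ^ 2 \<noteq> 1"
proof -
  have "\<exists>x::'a. poly [:1, 1, 1:] x = 0"
    by (rule alg_closed_imp_poly_has_root) auto
  then obtain \<omega> :: 'a where w: "1 + \<omega> + \<omega> ^ 2 = 0"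
    by (auto simp: algebra_simps power2_eq_square)
  have w1: "\<omega> \<noteq> 1"
    using w by auto
  have w3: "\<omega> ^ 3 = 1"
  proof -
    have "\<omega> ^ 3 - 1 = (\<omega> - 1) * (1 + \<omega> + \<omega> ^ 2)"
      by (simp add: algebra_simps power2_eq_square power3_eq_cube)
    then show ?thesis using w by simp
  qed
  have w2: "\<omega> ^ 2 \<noteq> 1"
    using w1 w3 by (auto simp: power3_eq_cube power2_eq_square)
  have "z \<in> {1, \<omega>, \<omega> ^ 2}" if "z ^ 3 = 1" for z
  proof -
    have a: "\<omega> ^ 2 = - 1 - \<omega>" using w by (simp add: eq_neg_iff_add_eq_0 algebra_simps)
    have "(z - \<omega>) * (z - \<omega> ^ 2) = z ^ 2 - (\<omega> + \<omega> ^ 2) * z + \<omega> ^ 3"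
      by (simp add: algebra_simps power2_eq_square power3_eq_cube)
    also have "\<dots> = z ^ 2 + z + 1" by (simp add: a w3)
    finally have "(z - 1) * ((z - \<omega>) * (z - \<omega> ^ 2)) = z ^ 3 - 1"
      by (simp add: algebra_simps power2_eq_square power3_eq_cube)
    then show ?thesis using that by auto
  qed
  moreover have "(\<omega> ^ 2) ^ 3 = 1"
    by (metis w3 power_mult mult.commute power_one)
  ultimately have "{z. z ^ 3 = 1} = {1, \<omega>, \<omega> ^ 2}"
    using w3 by auto
  then show ?thesis using that w w1 w2 w3 by blast
qed

text \<open>For \<open>z\<^sup>3 = 1\<close> the operator \<open>(1 + z\<^sup>2 A + z A\<^sup>2) / 3\<close> is the projection onto the
  \<open>z\<close>-eigenspace of \<open>A\<close>; it preserves the eigenvectors of every matrix that commutes with \<open>A\<close>.\<close>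

lemma span_common_eigenvectors:
  fixes T :: "('a::{alg_closed_field, field_char_0}^'n^'n) set"
  assumes "finite T"
    and "\<And>A. A \<in> T \<Longrightarrow> A ** A ** A = mat 1"
    and "\<And>A B. A \<in> T \<Longrightarrow> B \<in> T \<Longrightarrow> A ** B = B ** A"
  shows "vec.span {v. \<forall>A\<in>T. \<exists>c. A *v v = c *s v} = UNIV"
  using assms
proof (induction T)
  case empty
  then show ?case by simp
next
  case (insert A T)
  \<comment> \<open>Zero counts as an eigenvector here. Spans do not change, and a projection
    \<open>Q z v\<close> that happens to vanish needs no separate case.\<close>
  let ?E = "\<lambda>T. {v :: 'a^'n. \<forall>A\<in>T. \<exists>c. A *v v = c *s v}"
  obtain \<omega> :: 'a where w: "\<omega> ^ 3 = 1" "1 + \<omega> + \<omega> ^ 2 = 0"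
    by (metis primitive_cube_root)
  define Q where "Q z v = (1 / 3) *s (v + z ^ 2 *s (A *v v) + z *s (A *v (A *v v)))" for z :: 'a and v
  have A3: "A *v (A *v (A *v v)) = v" for v
    using insert.prems(1)[of A] by (simp add: matrix_vector_mul_assoc matrix_mul_assoc)
  have lin: "M *v (c *s v) = c *s (M *v v)" for M :: "'a^'n^'n" and c v
    by (simp add: vector_scalar_commute)
  have QA: "A *v Q z v = z *s Q z v" if z: "z ^ 3 = 1" for z v
  proof -
    have "A *v Q z v = (1 / 3) *s (A *v v + z ^ 2 *s (A *v (A *v v)) + z *s v)"
      by (simp add: Q_def lin matrix_vector_right_distrib A3)
    also have "\<dots> = z *s Q z v"
    proof -
      have "z * (x + z ^ 2 * a + z * b) = z ^ 3 * a + z ^ 2 * b + z * x" for x a b :: 'a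
        by (simp add: algebra_simps power2_eq_square power3_eq_cube)
      then have "a + z ^ 2 * b + z * x = z * (x + z ^ 2 * a + z * b)" for x a b :: 'a
        using z by simp
      then have "A *v v + z ^ 2 *s (A *v (A *v v)) + z *s v
          = z *s (v + z ^ 2 *s (A *v v) + z *s (A *v (A *v v)))"
        unfolding vec_eq_iff vector_add_component vector_smult_component by blast
      then show ?thesis
        unfolding Q_def by (simp only: vector_smult_assoc mult.commute[of z])
    qed
    finally show ?thesis .
  qed
  have QE: "Q z v \<in> ?E (insert A T)" if z: "z ^ 3 = 1" and v: "v \<in> ?E T" for z v
  proof -
    have "\<exists>c. B *v Q z v = c *s Q z v" if B: "B \<in> T" for B
    proof -
      from v B obtain c where c: "B *v v = c *s v" by blast
      have BA: "B *v (A *v u) = A *v (B *v u)" for u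
        using insert.prems(2)[of A B] B by (simp add: matrix_vector_mul_assoc)
      have "B *v Q z v = c *s Q z v"
        by (simp add: Q_def lin matrix_vector_right_distrib BA c)
           (simp add: vec_eq_iff algebra_simps)
      then show ?thesis by blast
    qed
    then show ?thesis using QA[OF z] by blast
  qed
  \<comment> \<open>In the sum of the three projections, the coefficients of \<open>A *v v\<close>
    and of its image under \<open>A\<close> are sums over all cube roots of unity, hence 0.\<close>
  have Qsum: "v = Q 1 v + Q \<omega> v + Q (\<omega> ^ 2) v" for v
  proof -
    have w4: "\<omega> ^ 4 = \<omega>" using w(1) by (simp add: power_Suc eval_nat_numeral)
    have w0: "1 + \<omega> ^ 2 + \<omega> ^ 4 = 0" using w(2) w4 by (simp add: algebra_simps)
    have "(1 / 3) * (x + 1 ^ 2 * a + 1 * b) + (1 / 3) * (x + \<omega> ^ 2 * a + \<omega> * b)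
        + (1 / 3) * (x + (\<omega> ^ 2) ^ 2 * a + \<omega> ^ 2 * b) = x" for x a b
    proof -
      have "(1 / 3) * (x + 1 ^ 2 * a + 1 * b) + (1 / 3) * (x + \<omega> ^ 2 * a + \<omega> * b)
          + (1 / 3) * (x + (\<omega> ^ 2) ^ 2 * a + \<omega> ^ 2 * b)
        = (1 / 3) * (3 * x + (1 + \<omega> ^ 2 + \<omega> ^ 4) * a + (1 + \<omega> + \<omega> ^ 2) * b)"
        by (simp add: field_simps)
      then show ?thesis unfolding w0 w(2) by simp
    qed
    then show ?thesis
      unfolding Q_def vec_eq_iff vector_add_component vector_smult_component by simp
  qed
  have "?E T \<subseteq> vec.span (?E (insert A T))"
  proof
    fix v assume v: "v \<in> ?E T"
    have "(\<omega> ^ 2) ^ 3 = 1" by (metis w(1) power_mult mult.commute power_one)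
    then have "Q 1 v + Q \<omega> v + Q (\<omega> ^ 2) v \<in> vec.span (?E (insert A T))"
      using QE[OF _ v] w(1) by (intro vec.span_add vec.span_base) auto
    then show "v \<in> vec.span (?E (insert A T))" using Qsum by metis
  qed
  then have "vec.span (?E T) \<subseteq> vec.span (?E (insert A T))"
    by (rule vec.span_minimal) (rule vec.subspace_span)
  moreover have "vec.span (?E T) = UNIV"
    by (rule insert.IH) (use insert.prems in blast)+
  ultimately show ?case by blast
qed

text \<open>The common eigenvectors span the space, so a maximal independent set of them is a basis;
  its members become the columns of \<open>P\<close>.\<close>

lemma common_eigenbasis:
  fixes T :: "('a::{alg_closed_field, field_char_0}^'n^'n) set"
  assumes "finite T"
    and "\<And>A. A \<in> T \<Longrightarrow> A ** A ** A = mat 1"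
    and "\<And>A B. A \<in> T \<Longrightarrow> B \<in> T \<Longrightarrow> A ** B = B ** A"
  obtains P :: "'a^'n^'n" where "invertible P" "\<And>A j. A \<in> T \<Longrightarrow> \<exists>c. A *v column j P = c *s column j P"
proof -
  let ?E = "{v :: 'a^'n. \<forall>A\<in>T. \<exists>c. A *v v = c *s v}"
  obtain B where B: "B \<subseteq> ?E" "vec.independent B" "?E \<subseteq> vec.span B"
    using vec.maximal_independent_subset by blast
  have sp: "vec.span B = UNIV"
    using span_common_eigenvectors[OF assms] B(3) vec.span_minimal[OF B(3) vec.subspace_span] by auto
  have "card B = vec.dim (UNIV :: ('a^'n) set)"
    by (rule vec.basis_card_eq_dim) (use sp B in auto)
  then have "card B = CARD('n)" by (simp add: vec_dim_card card_cart_basis)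
  moreover have "finite B" using B(2) vec.finiteI_independent by blast
  ultimately obtain p where p: "bij_betw p (UNIV :: 'n set) B"
    using finite_same_card_bij[of "UNIV :: 'n set" B] by auto
  define P where "P = (\<chi> i j. p j $ i)"
  have col: "column j P = p j" for j
    by (simp add: column_def P_def vec_eq_iff)
  then have "columns P = B"
    using p by (auto simp: columns_def bij_betw_def)
  then have "invertible P"
    using sp matrix_right_invertible_span_columns[of P] unfolding invertible_def
    by (metis matrix_left_right_inverse)
  moreover have "\<exists>c. A *v column j P = c *s column j P" if "A \<in> T" for A j
    using that B(1) p col by (auto simp: bij_betw_def)
  ultimately show ?thesis by (rule that)
qed

section \<open>Surfaces with an action of \<open>(\<int>\<^sub>3)\<^sup>3\<close>\<close>

lemma PGL4_commute_imp_commute: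
  fixes f :: "'a::field_char_0 poly4"
  assumes hom: "homogeneous4 3 f" and u: "eval4 f u \<noteq> 0"
    and A: "invertible A" "semi_invariant4 f A" and B: "invertible B" "semi_invariant4 f B"
    and comm: "pclass A \<otimes>\<^bsub>PGL4\<^esub> pclass B = pclass B \<otimes>\<^bsub>PGL4\<^esub> pclass A"
  shows "A ** B = B ** A"
proof -
  obtain a b where a: "a \<noteq> 0" "\<And>v. eval4 f (A *v v) = a * eval4 f v"
    and b: "b \<noteq> 0" "\<And>v. eval4 f (B *v v) = b * eval4 f v"
    using A(2) B(2) unfolding semi_invariant4_def by blast
  obtain c where c: "c \<noteq> 0" "A ** B = mat c ** (B ** A)"
    using comm A(1) B(1) by (metis pclass_mult pclass_eq_iff)
  \<comment> \<open>The value at \<open>(A ** B) *v u\<close> is computed in two ways; the factor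
    \<open>eval4 f u\<close> can then be cancelled.\<close>
  have "a * b * eval4 f u = eval4 f ((A ** B) *v u)"
    by (simp add: a(2) b(2) mult.assoc flip: matrix_vector_mul_assoc)
  also have "\<dots> = eval4 f (c *s (B *v (A *v u)))"
    by (simp add: c(2) flip: matrix_vector_mul_assoc)
  also have "\<dots> = c ^ 3 * (a * b * eval4 f u)"
    using hom unfolding homogeneous4_iff_eval4 by (simp add: a(2) b(2))
  finally have c3: "c ^ 3 = 1" using a(1) b(1) u by simp
  have "det A * det B = c ^ 4 * (det A * det B)"
    using arg_cong[OF c(2), of det] by (simp add: det_mul det_mat mult.commute)
  then have "c ^ 4 = 1" using A(1) B(1) by (simp add: invertible_det_nz)
  moreover have "c ^ 4 = c ^ 3 * c" by (simp add: eval_nat_numeral)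
  ultimately have "c = 1" using c3 by simp
  then show ?thesis using c(2) by simp
qed

text \<open>The cube of \<open>A\<close> is a scalar matrix, and rescaling \<open>A\<close> by a
  cube root of the inverse scalar makes the cube equal to 1.\<close>

lemma PGL4_cube_one_lift:
  fixes A :: "'a::alg_closed_field^4^4"
  assumes A: "invertible A" and cube: "pclass A \<otimes>\<^bsub>PGL4\<^esub> pclass A \<otimes>\<^bsub>PGL4\<^esub> pclass A = \<one>\<^bsub>PGL4\<^esub>"
  obtains c where "c \<noteq> 0" "(mat c ** A) ** (mat c ** A) ** (mat c ** A) = mat 1"
proof -
  have "pclass (A ** A ** A) = pclass (mat 1)"
    using cube A by (simp add: pclass_mult pclass_one invertible_mult)
  then obtain d where d: "d \<noteq> 0" "mat 1 = mat d ** (A ** A ** A)"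
    unfolding pclass_eq_iff by blast
  obtain c where c: "c ^ 3 = d"
    using nth_root_exists[of 3 d] by auto
  have "(mat c ** A) ** (mat c ** A) ** (mat c ** A) = mat (c * c * c) ** (A ** A ** A)"
    by (simp only: mat_mult_mult)
  also have "c * c * c = d" using c by (simp add: power3_eq_cube)
  finally have "(mat c ** A) ** (mat c ** A) ** (mat c ** A) = mat 1"
    using d(2) by simp
  moreover have "c \<noteq> 0" using c d(1) by auto
  ultimately show ?thesis using that by blast
qed

text \<open>These tuples represent the diagonal matrices of cube roots of unity modulo scalars: the
  last entry is normalized to 1.\<close>

definition cube_root_tuples :: "(4 \<Rightarrow> 'a::field) set" where
  "cube_root_tuples = {e. (\<forall>i. e i ^ 3 = 1) \<and> e 4 = 1}"

lemma card_cube_root_tuples: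
  "card (cube_root_tuples :: (4 \<Rightarrow> 'a::{alg_closed_field, field_char_0}) set) = 27"
proof -
  let ?M = "{z :: 'a. z ^ 3 = 1}"
  obtain \<omega> :: 'a where w: "\<omega> \<noteq> 1" "\<omega> ^ 3 = 1" "?M = {1, \<omega>, \<omega> ^ 2}" "\<omega> ^ 2 \<noteq> 1"
    by (rule primitive_cube_root)
  have "\<omega> \<noteq> 0" using w(2) by auto
  then have "\<omega> ^ 2 \<noteq> \<omega>" using w(1) by (simp add: power2_eq_square)
  then have M: "card ?M = 3" unfolding w(3) using w(1,4) by simp
  let ?g = "\<lambda>(a, b, c) i. if i = (1::4) then a else if i = 2 then b else if i = 3 then c else (1 :: 'a)"
  have "bij_betw ?g (?M \<times> ?M \<times> ?M) cube_root_tuples"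
  proof (rule bij_betw_byWitness[where f' = "\<lambda>e. (e 1, e 2, e 3)"])
    show "\<forall>e\<in>cube_root_tuples. ?g (e 1, e 2, e 3) = e"
    proof
      fix e :: "4 \<Rightarrow> 'a" assume "e \<in> cube_root_tuples"
      then show "?g (e 1, e 2, e 3) = e"
        by (auto simp: cube_root_tuples_def fun_eq_iff forall_4)
    qed
  qed (auto simp: cube_root_tuples_def)
  then have "card (cube_root_tuples :: (4 \<Rightarrow> 'a) set) = card (?M \<times> ?M \<times> ?M)"
    by (simp add: bij_betw_same_card)
  then show ?thesis by (simp add: card_cartesian_product M)
qed

lemma finite_cube_root_tuples:
  "finite (cube_root_tuples :: (4 \<Rightarrow> 'a::{alg_closed_field, field_char_0}) set)"
  using card_cube_root_tuples[where 'a = 'a] by (simp add: card_ge_0_finite)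

text \<open>Sending a class to its normalized tuple of eigenvalues is injective on \<open>K\<close>.
  Both \<open>K\<close> and \<open>cube_root_tuples\<close> have 27 elements, so every tuple
  occurs.\<close>

lemma PGL4_elementary_abelian_27:
  fixes f :: "'a::{alg_closed_field, field_char_0} poly4"
  assumes hom: "homogeneous4 3 f" and u: "eval4 f u \<noteq> 0"
    and K: "K \<subseteq> Aut4 f" "card K = 27"
    and comm: "\<And>x y. x \<in> K \<Longrightarrow> y \<in> K \<Longrightarrow> x \<otimes>\<^bsub>PGL4\<^esub> y = y \<otimes>\<^bsub>PGL4\<^esub> x"
    and cube: "\<And>x. x \<in> K \<Longrightarrow> x \<otimes>\<^bsub>PGL4\<^esub> x \<otimes>\<^bsub>PGL4\<^esub> x = \<one>\<^bsub>PGL4\<^esub>"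
  obtains P where "invertible P"
    "\<And>\<mu>. (\<forall>i. \<mu> i ^ 3 = 1) \<Longrightarrow> \<exists>c. \<forall>v. eval4 f (P *v (diag4 \<mu> *v v)) = c * eval4 f (P *v v)"
proof -
  have "\<exists>A. x = pclass A \<and> invertible A \<and> semi_invariant4 f A \<and> A ** A ** A = mat 1" if x: "x \<in> K" for x
  proof -
    obtain A where A: "x = pclass A" "invertible A" "semi_invariant4 f A"
      using x K(1) unfolding Aut4_eq by blast
    obtain c where c: "c \<noteq> 0" "(mat c ** A) ** (mat c ** A) ** (mat c ** A) = mat 1"
      using PGL4_cube_one_lift[OF A(2)] cube[OF x] unfolding A(1) by blast
    have "semi_invariant4 f (mat c ** A)"
    proof -
      obtain a where a: "a \<noteq> 0" "\<And>v. eval4 f (A *v v) = a * eval4 f v"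
        using A(3) unfolding semi_invariant4_def by blast
      have "eval4 f ((mat c ** A) *v v) = c ^ 3 * a * eval4 f v" for v
        using hom unfolding homogeneous4_iff_eval4 by (simp add: a(2) flip: matrix_vector_mul_assoc)
      then show ?thesis
        unfolding semi_invariant4_def using a(1) c(1) by (intro exI[of _ "c ^ 3 * a"]) auto
    qed
    moreover have "x = pclass (mat c ** A)"
      unfolding A(1) pclass_eq_iff using c(1) by blast
    moreover have "invertible (mat c ** A)"
      using A(2) c(1) by (simp add: invertible_mult invertible_mat)
    ultimately show ?thesis using c(2) by blast
  qed
  then obtain L where L: "\<And>x. x \<in> K \<Longrightarrow> x = pclass (L x)" "\<And>x. x \<in> K \<Longrightarrow> invertible (L x)"
    "\<And>x. x \<in> K \<Longrightarrow> semi_invariant4 f (L x)" "\<And>x. x \<in> K \<Longrightarrow> L x ** L x ** L x = mat 1"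
    by metis
  have finK: "finite K" using K(2) by (simp add: card_ge_0_finite)
  have Lcomm: "L x ** L y = L y ** L x" if "x \<in> K" "y \<in> K" for x y
    by (rule PGL4_commute_imp_commute[OF hom u]) (use L that comm in metis)+
  have LT: "A ** A ** A = mat 1" if "A \<in> L ` K" for A
    using that L(4) by blast
  have LT': "A ** B = B ** A" if "A \<in> L ` K" "B \<in> L ` K" for A B
    using that Lcomm by blast
  obtain P :: "'a^4^4" where P: "invertible P" "\<And>A j. A \<in> L ` K \<Longrightarrow> \<exists>c. A *v column j P = c *s column j P"
    using common_eigenbasis[OF finite_imageI[OF finK] LT LT'] by blast
  obtain d where d: "\<And>x j. x \<in> K \<Longrightarrow> L x *v column j P = d x j *s column j P"
  proof -
    have "\<forall>x j. \<exists>c. x \<in> K \<longrightarrow> L x *v column j P = c *s column j P"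
      using P(2) by blast
    then show ?thesis using that by metis
  qed
  have LP: "L x ** P = P ** diag4 (d x)" if "x \<in> K" for x
  proof -
    have "(L x ** P) $ i $ j = (P ** diag4 (d x)) $ i $ j" for i j
    proof -
      have "(L x ** P) $ i $ j = (L x *v column j P) $ i"
        by (simp add: matrix_matrix_mult_def matrix_vector_mult_def column_def)
      also have "\<dots> = (P ** diag4 (d x)) $ i $ j"
        unfolding d[OF that]
        by (simp add: column_def matrix_matrix_mult_def diag4_def if_distrib mult.commute cong: if_cong)
      finally show ?thesis .
    qed
    then show ?thesis by (simp add: vec_eq_iff)
  qed
  have P_cancel: "M = N" if "P ** M = P ** N" for M N :: "'a^4^4"
  proof -
    have "matrix_inv P ** (P ** M) = matrix_inv P ** (P ** N)" using that by simp
    then show ?thesis by (simp add: matrix_mul_assoc matrix_inv_left P(1))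
  qed
  have P_cancel': "M = N" if "M ** P = N ** P" for M N :: "'a^4^4"
  proof -
    have "(M ** P) ** matrix_inv P = (N ** P) ** matrix_inv P" using that by simp
    then show ?thesis by (simp add: matrix_inv_right P(1) flip: matrix_mul_assoc)
  qed
  have d3: "d x i ^ 3 = 1" if x: "x \<in> K" for x i
  proof -
    have step: "M ** P ** diag4 (d x) = M ** L x ** P" for M
      by (simp only: matrix_mul_assoc[symmetric] LP[OF x])
    have "P ** (diag4 (d x) ** diag4 (d x) ** diag4 (d x)) = L x ** L x ** L x ** P"
      by (simp only: matrix_mul_assoc LP[OF x, symmetric] step)
    then have "P ** diag4 (\<lambda>i. d x i * d x i * d x i) = P ** diag4 (\<lambda>_. 1)"
      using L(4)[OF x] by (simp add: diag4_mult diag4_one)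
    then have "(\<lambda>i. d x i * d x i * d x i) = (\<lambda>_. 1)"
      using P_cancel diag4_eq_iff by blast
    then show ?thesis by (metis power3_eq_cube)
  qed
  have d0: "d x i \<noteq> 0" if "x \<in> K" for x i
    using d3[OF that, of i] by auto
  \<comment> \<open>The quotient does not depend on the scaling of the lift.\<close>
  define e where "e x i = d x i / d x 4" for x i
  have "e ` K = cube_root_tuples"
  proof (rule card_seteq[OF finite_cube_root_tuples])
    show "e ` K \<subseteq> cube_root_tuples"
      using d3 d0 by (auto simp: cube_root_tuples_def e_def power_divide)
    have "inj_on e K"
    proof (rule inj_onI)
      fix x y assume xy: "x \<in> K" "y \<in> K" "e x = e y"
      \<comment> \<open>Equal normalized tuples give proportional diagonal matrices, with this
        factor; conjugating by \<open>P\<close>, the lifts are proportional and the classes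
        equal.\<close>
      define c where "c = d y 4 / d x 4"
      have c: "c \<noteq> 0" using d0 xy by (simp add: c_def)
      have "d y i = c * d x i" for i
        using fun_cong[OF xy(3), of i] d0[OF xy(1)] d0[OF xy(2)] by (simp add: e_def c_def field_simps)
      then have "diag4 (d y) = mat c ** diag4 (d x)"
        by (simp add: mat_mult_diag4 diag4_eq_iff fun_eq_iff)
      then have "L y ** P = P ** (mat c ** diag4 (d x))"
        using LP[OF xy(2)] by simp
      also have "\<dots> = mat c ** (P ** diag4 (d x))"
        by (simp only: matrix_mul_assoc mat_mult_commute[of P])
      also have "\<dots> = (mat c ** L x) ** P"
        by (simp only: LP[OF xy(1), symmetric] matrix_mul_assoc)
      finally have "L y = mat c ** L x" by (rule P_cancel')
      then have "pclass (L x) = pclass (L y)"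
        unfolding pclass_eq_iff using c by blast
      then show "x = y" using L(1) xy by metis
    qed
    then show "card (cube_root_tuples :: (4 \<Rightarrow> 'a) set) \<le> card (e ` K)"
      by (simp add: card_image K(2) card_cube_root_tuples)
  qed
  have "\<exists>c. \<forall>v. eval4 f (P *v (diag4 \<mu> *v v)) = c * eval4 f (P *v v)" if \<mu>: "\<forall>i. \<mu> i ^ 3 = 1" for \<mu>
  proof -
    have \<mu>0: "\<mu> i \<noteq> 0" for i using \<mu>[rule_format, of i] by auto
    have "(\<lambda>i. \<mu> i / \<mu> 4) \<in> cube_root_tuples"
      using \<mu> \<mu>0 by (simp add: cube_root_tuples_def power_divide)
    then obtain x where x: "x \<in> K" "(\<lambda>i. \<mu> i / \<mu> 4) = e x"
      using \<open>e ` K = cube_root_tuples\<close> by (metis imageE)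
    define c where "c = \<mu> 4 / d x 4"
    have "\<mu> i = c * d x i" for i
      using fun_cong[OF x(2), of i] \<mu>0[of 4] d0[OF x(1), of 4] by (simp add: e_def c_def field_simps)
    then have "diag4 \<mu> = mat c ** diag4 (d x)"
      by (simp add: mat_mult_diag4 diag4_eq_iff fun_eq_iff)
    then have "P ** diag4 \<mu> = mat c ** (P ** diag4 (d x))"
      by (simp only: matrix_mul_assoc mat_mult_commute[of P])
    also have "\<dots> = mat c ** (L x ** P)" by (simp only: LP[OF x(1)])
    finally have eq: "P *v (diag4 \<mu> *v v) = c *s (L x *v (P *v v))" for v
      by (simp add: matrix_vector_mul_assoc) (simp flip: matrix_vector_mul_assoc)
    obtain a where a: "\<And>v. eval4 f (L x *v v) = a * eval4 f v"
      using L(3)[OF x(1)] unfolding semi_invariant4_def by blast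
    have "eval4 f (P *v (diag4 \<mu> *v v)) = c ^ 3 * a * eval4 f (P *v v)" for v
      using hom unfolding homogeneous4_iff_eval4 by (simp add: eq a)
    then show ?thesis by blast
  qed
  then show ?thesis using that P(1) by blast
qed

section \<open>Cubic forms with diagonal symmetries\<close>

lemma omega_power_eq_imp_mod_eq:
  fixes \<omega> :: "'a::field"
  assumes w: "\<omega> \<noteq> 1" "\<omega> ^ 2 \<noteq> 1" "\<omega> ^ 3 = 1" and eq: "\<omega> ^ a = \<omega> ^ b"
  shows "a mod 3 = b mod (3::nat)"
proof -
  have red: "\<omega> ^ n = \<omega> ^ (n mod 3)" for n :: nat
  proof -
    have "\<omega> ^ n = \<omega> ^ (3 * (n div 3) + n mod 3)" by simp
    also have "\<dots> = \<omega> ^ (n mod 3)" unfolding power_add power_mult w(3) by simp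
    finally show ?thesis .
  qed
  have "\<omega> \<noteq> 0" using w(3) by auto
  then have w': "\<omega> ^ 2 \<noteq> \<omega>" using w(1) by (simp add: power2_eq_square)
  have n: "n mod 3 = 0 \<or> n mod 3 = 1 \<or> n mod 3 = 2" for n :: nat by linarith
  have "\<omega> ^ (a mod 3) = \<omega> ^ (b mod 3)" using eq red by metis
  then show ?thesis using n[of a] n[of b] w w' by auto
qed

text \<open>At the \<open>i\<close>-th coordinate point the gradient consists of the coefficients of the monomials
  \<open>x\<^sub>i\<^sup>2x\<^sub>j\<close>, up to the factor 3 for \<open>j = i\<close>.\<close>

lemma nonsingular_cubic_exponent_ge_2:
  fixes g :: "'a::{idom, ring_char_0} poly4"
  assumes hom: "homogeneous4 3 g"
    and ns: "\<And>v. v \<noteq> 0 \<Longrightarrow> \<exists>w. \<not> (\<exists>q. \<forall>s. eval4 g (v + s *s w) = s ^ 2 * poly q s)"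
  shows "\<exists>m\<in>Poly_Mapping.keys g. Poly_Mapping.lookup m i \<ge> 2"
proof (rule ccontr)
  let ?l = "Poly_Mapping.lookup"
  assume "\<not> ?thesis"
  then have le: "?l m i \<le> 1" if "m \<in> Poly_Mapping.keys g" for m
    using that by force
  have "axis i 1 \<noteq> (0 :: 'a^4)" by (simp add: axis_eq_0_iff)
  then obtain w where w: "\<not> (\<exists>q. \<forall>s. eval4 g (axis i 1 + s *s w) = s ^ 2 * poly q s)"
    using ns by blast
  \<comment> \<open>The degree of the monomial in the other variables. It is at least 2, as the
    total degree is 3 and \<open>i\<close> has exponent at most 1; this produces the factor
    \<open>s ^ 2\<close>.\<close>
  define k where "k m = (\<Sum>j\<in>UNIV - {i}. ?l m j)" for m :: "4 \<Rightarrow>\<^sub>0 nat"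
  define R where "R m = (\<Prod>j\<in>UNIV - {i}. w $ j ^ ?l m j)" for m
  have mono: "mono4 m (axis i 1 + s *s w) = s ^ 2 * poly ([:1, w $ i:] ^ ?l m i * monom (R m) (k m - 2)) s"
    if m: "m \<in> Poly_Mapping.keys g" for m s
  proof -
    have "(\<Sum>j\<in>UNIV. ?l m j) = 3" using hom m unfolding homogeneous4_def by blast
    then have "?l m i + k m = 3" unfolding k_def by (simp add: sum.remove[of _ i])
    then have "k m = (k m - 2) + 2" using le[OF m] by linarith
    then have s: "s ^ k m = s ^ (k m - 2) * s ^ 2" by (metis power_add)
    have "mono4 m (axis i 1 + s *s w) = (1 + s * w $ i) ^ ?l m i * (\<Prod>j\<in>UNIV - {i}. (s * w $ j) ^ ?l m j)"
      unfolding mono4_def by (subst prod.remove[of _ i]) (auto simp: axis_def intro!: prod.cong)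
    also have "(\<Prod>j\<in>UNIV - {i}. (s * w $ j) ^ ?l m j) = s ^ k m * R m"
      by (simp add: power_mult_distrib prod.distrib k_def R_def power_sum)
    finally show ?thesis by (simp add: s poly_monom poly_power mult_ac)
  qed
  have "eval4 g (axis i 1 + s *s w)
      = s ^ 2 * poly (\<Sum>m\<in>Poly_Mapping.keys g. [:?l g m:] * ([:1, w $ i:] ^ ?l m i * monom (R m) (k m - 2))) s" for s
    unfolding eval4_keys poly_sum sum_distrib_left
    by (rule sum.cong) (simp_all add: mono mult_ac)
  then show False using w by blast
qed

text \<open>Invariance makes the exponent vectors of all monomials congruent modulo 3. As for each \<open>i\<close>
  some exponent vector has a value of at least 2 at \<open>i\<close>, and the values of each sum to 3, they are
  all congruent to 0.\<close>

lemma diagonal_nonsingular_cubic: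
  fixes g :: "'a::{alg_closed_field, field_char_0} poly4"
  assumes hom: "homogeneous4 3 g"
    and ns: "\<And>v. v \<noteq> 0 \<Longrightarrow> \<exists>w. \<not> (\<exists>q. \<forall>s. eval4 g (v + s *s w) = s ^ 2 * poly q s)"
    and inv: "\<And>\<mu>. (\<forall>i. \<mu> i ^ 3 = 1) \<Longrightarrow> \<exists>c. \<forall>v. eval4 g (diag4 \<mu> *v v) = c * eval4 g v"
  obtains a where "\<And>i. a i \<noteq> 0" "\<And>v. eval4 g v = (\<Sum>i\<in>UNIV. a i * v $ i ^ 3)"
proof -
  let ?l = "Poly_Mapping.lookup" and ?K = "Poly_Mapping.keys g"
  obtain \<omega> :: 'a where w: "\<omega> \<noteq> 1" "\<omega> ^ 2 \<noteq> 1" "\<omega> ^ 3 = 1"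
    by (metis primitive_cube_root)
  have cong: "?l m i mod 3 = ?l m' i mod 3" if "m \<in> ?K" "m' \<in> ?K" for m m' i
  proof -
    \<comment> \<open>Scaling a single variable by \<omega> isolates its exponent modulo 3.\<close>
    let ?\<mu> = "\<lambda>j. if j = i then \<omega> else 1"
    obtain c where c: "\<And>v. eval4 g (\<chi> j. ?\<mu> j * v $ j) = c * eval4 g v"
    proof -
      have "\<forall>j. ?\<mu> j ^ 3 = 1" using w(3) by simp
      from inv[OF this] show ?thesis using that unfolding diag4_mult_vec by blast
    qed
    have "\<omega> ^ ?l n i = c" if "n \<in> ?K" for n
    proof -
      have "(\<Prod>j\<in>UNIV. ?\<mu> j ^ ?l n j) = (\<Prod>j\<in>UNIV. if j = i then \<omega> ^ ?l n i else 1)"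
        by (rule prod.cong) auto
      then have "(\<Prod>j\<in>UNIV. ?\<mu> j ^ ?l n j) = \<omega> ^ ?l n i" by simp
      then show ?thesis
        using lookup_diagonal_semi_invariant[where g = g and d = ?\<mu> and m = n, OF c] that
        by (simp add: in_keys_iff)
    qed
    then have "\<omega> ^ ?l m i = \<omega> ^ ?l m' i" using that by simp
    then show ?thesis by (rule omega_power_eq_imp_mod_eq[OF w])
  qed
  have sum3: "?l m 1 + ?l m 2 + ?l m 3 + ?l m 4 = 3" if "m \<in> ?K" for m
    using hom that unfolding homogeneous4_def by (simp add: sum_4)
  have le3: "?l m i \<le> 3" if "m \<in> ?K" for m i
    using sum3[OF that] exhaust_4[of i] by auto
  have ge2: "\<exists>m\<in>?K. ?l m i \<ge> 2" for i
    by (rule nonsingular_cubic_exponent_ge_2[OF hom ns])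
  \<comment> \<open>Some monomial has exponent 2 or 3 at \<open>i\<close>, and all monomials share
    its residue, which is 2 or 0.\<close>
  have not1: "?l m i mod 3 \<noteq> 1" if "m \<in> ?K" for m i
  proof -
    obtain m' where "m' \<in> ?K" "?l m' i \<ge> 2" using ge2 by blast
    moreover have "?l m' i mod 3 \<noteq> 1" using calculation le3[of m' i] by presburger
    ultimately show ?thesis using cong that by metis
  qed
  \<comment> \<open>An exponent 2 would leave exponent 1 for another variable, whose residue has
    just been excluded.\<close>
  have cube: "?l m i = 0 \<or> ?l m i = 3" if m: "m \<in> ?K" for m i
  proof (rule ccontr)
    assume "\<not> ?thesis"
    then have two: "?l m i = 2" using le3[OF m, of i] not1[OF m, of i] by presburger
    have n1: "?l m j \<noteq> 1" for j using not1[OF m, of j] by auto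
    have "?l m 1 = 2 \<or> ?l m 2 = 2 \<or> ?l m 3 = 2 \<or> ?l m 4 = 2"
      using two exhaust_4[of i] by auto
    then show False
      using sum3[OF m] n1[of 1] n1[of 2] n1[of 3] n1[of 4] by linarith
  qed
  have single: "m = Poly_Mapping.single i 3" if m: "m \<in> ?K" "?l m i \<noteq> 0" for m i
  proof (rule poly_mapping_eqI)
    fix j
    show "?l m j = ?l (Poly_Mapping.single i 3) j"
    proof (cases "j = i")
      case True
      then show ?thesis using cube[OF m(1), of i] m(2) by simp
    next
      case False
      have "(\<Sum>k\<in>{i, j}. ?l m k) \<le> (\<Sum>k\<in>UNIV. ?l m k)" by (rule sum_mono2) auto
      then have "?l m i + ?l m j \<le> 3" using False sum3[OF m(1)] by (simp add: sum_4)
      then have "?l m j = 0" using cube[OF m(1), of i] cube[OF m(1), of j] m(2) by auto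
      then show ?thesis using False by (simp add: lookup_single when_def)
    qed
  qed
  define a where "a i = ?l g (Poly_Mapping.single i 3)" for i
  have "a i \<noteq> 0" for i
  proof -
    obtain m where m: "m \<in> ?K" "?l m i \<ge> 2" using ge2 by blast
    then have "m = Poly_Mapping.single i 3" by (intro single) auto
    then show ?thesis using m(1) by (simp add: a_def in_keys_iff)
  qed
  moreover have "eval4 g v = (\<Sum>i\<in>UNIV. a i * v $ i ^ 3)" for v
  proof -
    have sub: "?K \<subseteq> (\<lambda>i. Poly_Mapping.single i 3) ` UNIV"
    proof
      fix m assume m: "m \<in> ?K"
      have "\<exists>i. ?l m i \<noteq> 0" using sum3[OF m] by (metis add_0 zero_neq_numeral)
      then show "m \<in> (\<lambda>i. Poly_Mapping.single i 3) ` UNIV" using single[OF m] by blast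
    qed
    have inj: "inj (\<lambda>i::4. Poly_Mapping.single i (3::nat))"
    proof (rule injI)
      fix i j :: 4
      assume "Poly_Mapping.single i (3::nat) = Poly_Mapping.single j 3"
      then have "?l (Poly_Mapping.single i (3::nat)) i = ?l (Poly_Mapping.single j 3) i" by simp
      then show "i = j" by (auto simp: lookup_single when_def split: if_splits)
    qed
    show ?thesis
      by (subst eval4_eq_sum[OF _ sub]) (simp_all add: sum.reindex[OF inj] a_def mono4_single)
  qed
  ultimately show ?thesis by (rule that)
qed

text \<open>A form without nonzero values would be divisible by \<open>s ^ 2\<close> on every line.
  The point \<open>u\<close> allows the cancellation in
  \<open>PGL4_commute_imp_commute\<close>.\<close>

lemma nonsingular4_imp_nonzero_value:
  fixes f :: "'a::{idom, ring_char_0} poly4"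
  assumes "nonsingular4 f"
  obtains u where "eval4 f u \<noteq> 0"
proof -
  have "axis 1 1 \<noteq> (0 :: 'a^4)" by (simp add: axis_eq_0_iff)
  from nonsingular4_no_double_zero[OF assms this] obtain w
    where w: "\<not> (\<exists>q. \<forall>s. eval4 f (axis 1 1 + s *s w) = s ^ 2 * poly q s)" by blast
  then obtain s where "eval4 f (axis 1 1 + s *s w) \<noteq> 0"
    by (metis poly_0 mult_zero_right)
  then show ?thesis by (rule that)
qed

lemma elementary_abelian_27_imp_fermat:
  fixes f :: "'a::{alg_closed_field, field_char_0} poly4"
  assumes f: "nonsingular_cubic_surface f"
    and K: "K \<subseteq> Aut4 f" "card K = 27"
    and comm: "\<And>x y. x \<in> K \<Longrightarrow> y \<in> K \<Longrightarrow> x \<otimes>\<^bsub>PGL4\<^esub> y = y \<otimes>\<^bsub>PGL4\<^esub> x"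
    and cube: "\<And>x. x \<in> K \<Longrightarrow> x \<otimes>\<^bsub>PGL4\<^esub> x \<otimes>\<^bsub>PGL4\<^esub> x = \<one>\<^bsub>PGL4\<^esub>"
  shows "proj_equivalent f fermat_cubic"
proof -
  have hom: "homogeneous4 3 f" and ns: "nonsingular4 f"
    using f unfolding nonsingular_cubic_surface_def by auto
  obtain u where u: "eval4 f u \<noteq> 0" using ns by (rule nonsingular4_imp_nonzero_value)
  obtain P where P: "invertible P"
    "\<And>\<mu>. (\<forall>i. \<mu> i ^ 3 = 1) \<Longrightarrow> \<exists>c. \<forall>v. eval4 f (P *v (diag4 \<mu> *v v)) = c * eval4 f (P *v v)"
    using PGL4_elementary_abelian_27[OF hom u K comm cube] by blast
  define g where "g = act4 (matrix_inv P) f"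
  have g: "eval4 g v = eval4 f (P *v v)" for v
    by (simp add: g_def eval4_act4 matrix_inv_matrix_inv P(1))
  have hom_g: "homogeneous4 3 g"
    using hom unfolding homogeneous4_iff_eval4 g by (simp add: vector_scalar_commute)
  \<comment> \<open>Linear maps carry lines to lines, so a direction found for \<open>f\<close> is
    pulled back along \<open>P\<close>.\<close>
  have ns_g: "\<exists>w. \<not> (\<exists>q. \<forall>s. eval4 g (v + s *s w) = s ^ 2 * poly q s)" if v: "v \<noteq> 0" for v
  proof -
    have "P *v v \<noteq> 0" using matrix_inv_vec_left[OF P(1), of v] v by force
    then obtain w where w: "\<not> (\<exists>q. \<forall>s. eval4 f (P *v v + s *s w) = s ^ 2 * poly q s)"
      using nonsingular4_no_double_zero[OF ns] by blast
    have "eval4 g (v + s *s (matrix_inv P *v w)) = eval4 f (P *v v + s *s w)" for s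
      by (simp add: g matrix_vector_right_distrib matrix_inv_vec_right[OF P(1)] vector_scalar_commute)
    then show ?thesis using w by (intro exI[of _ "matrix_inv P *v w"]) simp
  qed
  have inv_g: "\<exists>c. \<forall>v. eval4 g (diag4 \<mu> *v v) = c * eval4 g v" if "\<forall>i. \<mu> i ^ 3 = 1" for \<mu>
    unfolding g using P(2)[OF that] .
  obtain a where a: "\<And>i. a i \<noteq> 0" "\<And>v. eval4 g v = (\<Sum>i\<in>UNIV. a i * v $ i ^ 3)"
    using diagonal_nonsingular_cubic[OF hom_g ns_g inv_g] by blast
  \<comment> \<open>Rescaling the coordinates by these cube roots turns every coefficient into
    1.\<close>
  have "\<exists>b. b ^ 3 = 1 / a i" for i
    using nth_root_exists[of 3 "1 / a i"] by auto
  then obtain b where b: "\<And>i. b i ^ 3 = 1 / a i" by metis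
  have "b i \<noteq> 0" for i using a(1)[of i] b[of i] by auto
  then have "invertible (P ** diag4 b)"
    using P(1) by (simp add: invertible_mult invertible_diag4)
  moreover have "eval4 fermat_cubic v = eval4 f ((P ** diag4 b) *v v)" for v
    using a(1) by (simp add: eval4_fermat a(2) diag4_mult_vec power_mult_distrib b mult.assoc[symmetric]
        flip: matrix_vector_mul_assoc g)
  ultimately show ?thesis by (rule proj_equivalentI)
qed

text \<open>The hypothesis \<open>idem\<close> stands in for the group laws of \<open>G\<close>: it
  makes the isomorphism preserve the identity, so the semidirect product need not be shown to be a
  group.\<close>

lemma group_invariant_imp_fermat:
  fixes f :: "'a::{alg_closed_field, field_char_0} poly4"
  assumes f: "nonsingular_cubic_surface f" and inv: "group_invariant G f"
    and idem: "\<And>e. e \<in> carrier G \<Longrightarrow> e \<otimes>\<^bsub>G\<^esub> e = e \<Longrightarrow> e = \<one>\<^bsub>G\<^esub>"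
    and C: "C \<subseteq> carrier G" "card C = 27"
    and comm: "\<And>x y. x \<in> C \<Longrightarrow> y \<in> C \<Longrightarrow> x \<otimes>\<^bsub>G\<^esub> y = y \<otimes>\<^bsub>G\<^esub> x"
    and cube: "\<And>x. x \<in> C \<Longrightarrow> x \<otimes>\<^bsub>G\<^esub> x \<otimes>\<^bsub>G\<^esub> x = \<one>\<^bsub>G\<^esub>"
  shows "proj_equivalent f fermat_cubic"
proof -
  obtain H \<phi> where H: "subgroup H (PGL4\<lparr>carrier := Aut4 f\<rparr>)"
    and \<phi>: "\<phi> \<in> iso (PGL4\<lparr>carrier := H\<rparr>) G"
    using inv unfolding group_invariant_def is_iso_def by blast
  have bij: "bij_betw \<phi> H (carrier G)"
    using \<phi> by (simp add: iso_def)
  have hom: "\<phi> (x \<otimes>\<^bsub>PGL4\<^esub> y) = \<phi> x \<otimes>\<^bsub>G\<^esub> \<phi> y" if "x \<in> H" "y \<in> H" for x y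
    using \<phi> that by (simp add: iso_def hom_def)
  have closed: "x \<otimes>\<^bsub>PGL4\<^esub> y \<in> H" if "x \<in> H" "y \<in> H" for x y
    using subgroup.m_closed[OF H that] by simp
  have one: "\<one>\<^bsub>PGL4\<^esub> \<in> H"
    using subgroup.one_closed[OF H] by simp
  have inj: "x = y" if "x \<in> H" "y \<in> H" "\<phi> x = \<phi> y" for x y
    using bij that by (auto simp: bij_betw_def inj_on_def)
  have \<phi>1: "\<phi> \<one>\<^bsub>PGL4\<^esub> = \<one>\<^bsub>G\<^esub>"
  proof (rule idem)
    show "\<phi> \<one>\<^bsub>PGL4\<^esub> \<in> carrier G" using bij one by (auto simp: bij_betw_def)
    have "\<one>\<^bsub>PGL4\<^esub> \<otimes>\<^bsub>PGL4\<^esub> \<one>\<^bsub>PGL4\<^esub> = (\<one>\<^bsub>PGL4\<^esub> :: ('a^4^4) set)"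
      by (simp add: group.is_monoid group_PGL4)
    then show "\<phi> \<one>\<^bsub>PGL4\<^esub> \<otimes>\<^bsub>G\<^esub> \<phi> \<one>\<^bsub>PGL4\<^esub> = \<phi> \<one>\<^bsub>PGL4\<^esub>"
      using hom[OF one one] by simp
  qed
  define K where "K = {h \<in> H. \<phi> h \<in> C}"
  have "\<phi> ` K = C"
    using bij C(1) unfolding K_def bij_betw_def by (auto simp: image_iff)
  moreover have "inj_on \<phi> K"
    using bij unfolding K_def bij_betw_def by (auto simp: inj_on_def)
  ultimately have card: "card K = 27"
    using C(2) by (metis card_image)
  show ?thesis
  proof (rule elementary_abelian_27_imp_fermat[OF f _ card])
    show "K \<subseteq> Aut4 f"
      using subgroup.subset[OF H] by (auto simp: K_def)
  next
    fix x y assume "x \<in> K" "y \<in> K"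
    then have xy: "x \<in> H" "y \<in> H" "\<phi> x \<in> C" "\<phi> y \<in> C" by (auto simp: K_def)
    show "x \<otimes>\<^bsub>PGL4\<^esub> y = y \<otimes>\<^bsub>PGL4\<^esub> x"
      by (rule inj) (simp_all add: closed hom xy comm)
  next
    fix x assume "x \<in> K"
    then have x: "x \<in> H" "\<phi> x \<in> C" by (auto simp: K_def)
    show "x \<otimes>\<^bsub>PGL4\<^esub> x \<otimes>\<^bsub>PGL4\<^esub> x = \<one>\<^bsub>PGL4\<^esub>"
      by (rule inj) (simp_all add: closed hom x cube one \<phi>1)
  qed
qed

section \<open>The two groups of the theorem\<close>

lemma Z3_cubed_invariant_imp_fermat:
  fixes f :: "'a::{alg_closed_field, field_char_0} poly4"
  assumes f: "nonsingular_cubic_surface f" and inv: "group_invariant Z3_cubed f"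
  shows "proj_equivalent f fermat_cubic"
proof (rule group_invariant_imp_fermat[OF f inv])
  have carrier: "carrier Z3_cubed = {0..<3} \<times> {0..<3} \<times> {0..<3}"
    by (simp add: Z3_cubed_def carrier_integer_mod_group)
  show "card (carrier Z3_cubed) = 27" unfolding carrier by simp
  fix x assume x: "x \<in> carrier Z3_cubed"
  then obtain a b c where abc: "x = (a, b, c)" "a \<in> {0..<3}" "b \<in> {0..<3}" "c \<in> {0..<3}"
    unfolding carrier by auto
  have idem: "n = 0" if "n \<in> {0..<3}" "(n + n) mod 3 = n" for n :: int
  proof -
    have "0 \<le> n" "n < 3" using that(1) by auto
    then show ?thesis using that(2) by presburger
  qed
  show "x = \<one>\<^bsub>Z3_cubed\<^esub>" if "x \<otimes>\<^bsub>Z3_cubed\<^esub> x = x"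
    using that abc idem by (simp add: Z3_cubed_def)
  have "((n + n) mod 3 + n) mod 3 = 0" for n :: int by presburger
  then show "x \<otimes>\<^bsub>Z3_cubed\<^esub> x \<otimes>\<^bsub>Z3_cubed\<^esub> x = \<one>\<^bsub>Z3_cubed\<^esub>"
    by (simp add: abc Z3_cubed_def)
  show "x \<otimes>\<^bsub>Z3_cubed\<^esub> y = y \<otimes>\<^bsub>Z3_cubed\<^esub> x" for y
    by (cases x; cases y) (auto simp: Z3_cubed_def add.commute)
qed simp

lemma D3_eq: "D3 = {diag4 l | l. (\<forall>i. l i \<noteq> 0) \<and> (\<forall>i. l i ^ 3 = l 4 ^ 3)}"
  unfolding D3_def GL4_def by (auto simp: invertible_diag4 forall_4)

text \<open>Division by the last entry keeps the class and turns equal cubes into cubes equal to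
  1.\<close>

lemma pclass_image_D3:
  "pclass ` D3 = (\<lambda>e. pclass (diag4 e)) ` (cube_root_tuples :: (4 \<Rightarrow> 'a::field) set)"
proof (intro equalityI subsetI)
  fix x :: "('a^4^4) set" assume "x \<in> pclass ` D3"
  then obtain l where l: "x = pclass (diag4 l)" "\<And>i. l i \<noteq> 0" "\<And>i. l i ^ 3 = l 4 ^ 3"
    unfolding D3_eq by blast
  let ?e = "\<lambda>i. l i / l 4"
  have "?e i ^ 3 = 1" for i
    unfolding power_divide l(3)[of i] using l(2)[of 4] by simp
  then have "?e \<in> cube_root_tuples"
    using l(2) by (simp add: cube_root_tuples_def)
  moreover have "x = pclass (diag4 ?e)"
    unfolding l(1) pclass_eq_iff using l(2) by (intro exI[of _ "1 / l 4"]) (simp add: mat_mult_diag4)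
  ultimately show "x \<in> (\<lambda>e. pclass (diag4 e)) ` cube_root_tuples" by blast
next
  fix x :: "('a^4^4) set" assume "x \<in> (\<lambda>e. pclass (diag4 e)) ` cube_root_tuples"
  then obtain e where e: "x = pclass (diag4 e)" "\<And>i. e i ^ 3 = 1"
    unfolding cube_root_tuples_def by blast
  have "e i \<noteq> 0" for i using e(2)[of i] by auto
  then show "x \<in> pclass ` D3"
    unfolding D3_eq e(1) using e(2) by (intro imageI CollectI exI[of _ e]) simp
qed

lemma card_pclass_D3:
  "card (pclass ` (D3 :: ('a::{alg_closed_field, field_char_0}^4^4) set)) = 27"
proof -
  have "inj_on (\<lambda>e. pclass (diag4 e)) (cube_root_tuples :: (4 \<Rightarrow> 'a) set)"
  proof (rule inj_onI)
    fix d e :: "4 \<Rightarrow> 'a"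
    assume de: "d \<in> cube_root_tuples" "e \<in> cube_root_tuples" "pclass (diag4 d) = pclass (diag4 e)"
    obtain c where "diag4 e = mat c ** diag4 d"
      using de(3) unfolding pclass_eq_iff by blast
    then have c: "e i = c * d i" for i
      unfolding mat_mult_diag4 diag4_eq_iff by simp
    \<comment> \<open>Both fourth entries are 1, hence \<open>c = 1\<close>.\<close>
    with c[of 4] de(1,2) show "d = e"
      by (auto simp: cube_root_tuples_def)
  qed
  then show ?thesis
    unfolding pclass_image_D3 by (simp add: card_image card_cube_root_tuples)
qed

lemma perm_mat_one: "perm_mat \<one>\<^bsub>S4\<^esub> = mat 1"
proof -
  have "\<one>\<^bsub>S4\<^esub> = id" by (simp add: BijGroup_def id_def restrict_def)
  then show ?thesis
    by (auto simp: perm_mat_def mat_def vec_eq_iff inv_id[unfolded id_def] id_def)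
qed

text \<open>The 27 elements are the pairs with trivial permutation. On them the twist is conjugation
  by the identity, so they multiply as in \<open>PGL4\<close>.\<close>

lemma D3_semidirect_S4_invariant_imp_fermat:
  fixes f :: "'a::{alg_closed_field, field_char_0} poly4"
  assumes f: "nonsingular_cubic_surface f"
    and inv: "group_invariant (D3_semidirect_S4 :: (('a^4^4) set \<times> (4 \<Rightarrow> 4)) monoid) f"
  shows "proj_equivalent f fermat_cubic"
proof -
  interpret S: group S4 by (rule group_BijGroup)
  interpret P: group "PGL4 :: ('a^4^4) set monoid" by (rule group_PGL4)
  let ?G = "D3_semidirect_S4 :: (('a^4^4) set \<times> (4 \<Rightarrow> 4)) monoid"
  let ?D = "pclass ` (D3 :: ('a^4^4) set)"
  have carrier: "carrier ?G = ?D \<times> carrier S4" and one: "\<one>\<^bsub>?G\<^esub> = (\<one>\<^bsub>PGL4\<^esub>, \<one>\<^bsub>S4\<^esub>)"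
    by (simp_all add: D3_semidirect_S4_def)
  have D: "?D \<subseteq> carrier PGL4"
    by (auto simp: carrier_PGL4 D3_def GL4_def)
  have mult: "(a, \<one>\<^bsub>S4\<^esub>) \<otimes>\<^bsub>?G\<^esub> (b, \<one>\<^bsub>S4\<^esub>) = (a \<otimes>\<^bsub>PGL4\<^esub> b, \<one>\<^bsub>S4\<^esub>)" if "b \<in> ?D" for a b
  proof -
    have "b \<in> carrier PGL4" using that D by blast
    then show ?thesis
      by (simp add: D3_semidirect_S4_def perm_mat_one flip: pclass_one)
  qed
  show ?thesis
  proof (rule group_invariant_imp_fermat[OF f inv])
    show "?D \<times> {\<one>\<^bsub>S4\<^esub>} \<subseteq> carrier ?G" unfolding carrier by auto
    show "card (?D \<times> {\<one>\<^bsub>S4\<^esub>}) = 27" by (simp add: card_cartesian_product card_pclass_D3)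
  next
    fix e assume e: "e \<in> carrier ?G" "e \<otimes>\<^bsub>?G\<^esub> e = e"
    obtain a \<sigma> where a: "e = (a, \<sigma>)" by (cases e)
    have as: "a \<in> ?D" "\<sigma> \<in> carrier S4" using e(1) unfolding carrier a by auto
    have "\<sigma> \<otimes>\<^bsub>S4\<^esub> \<sigma> = \<sigma>" using e(2) unfolding a by (simp add: D3_semidirect_S4_def)
    \<comment> \<open>The permutation is settled first, since the rule \<open>mult\<close> applies
      only when it is trivial.\<close>
    then have \<sigma>: "\<sigma> = \<one>\<^bsub>S4\<^esub>" using as(2) by simp
    have aP: "a \<in> carrier PGL4" using as(1) D by blast
    have "a \<otimes>\<^bsub>PGL4\<^esub> a = a" using e(2) mult[OF as(1)] unfolding a \<sigma> by simp
    then have "a = \<one>\<^bsub>PGL4\<^esub>" using P.l_cancel_one[OF aP aP] by simp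
    then show "e = \<one>\<^bsub>?G\<^esub>" unfolding a \<sigma> one by simp
  next
    fix x y assume "x \<in> ?D \<times> {\<one>\<^bsub>S4\<^esub>}" "y \<in> ?D \<times> {\<one>\<^bsub>S4\<^esub>}"
    then obtain a b where ab: "x = (a, \<one>\<^bsub>S4\<^esub>)" "y = (b, \<one>\<^bsub>S4\<^esub>)" "a \<in> ?D" "b \<in> ?D" by auto
    obtain d e where "a = pclass (diag4 d)" "b = pclass (diag4 e)"
      "invertible (diag4 d)" "invertible (diag4 e)"
      using ab(3,4) unfolding D3_def GL4_def by auto
    then have "a \<otimes>\<^bsub>PGL4\<^esub> b = b \<otimes>\<^bsub>PGL4\<^esub> a"
      by (simp add: pclass_mult diag4_mult mult.commute)
    then show "x \<otimes>\<^bsub>?G\<^esub> y = y \<otimes>\<^bsub>?G\<^esub> x"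
      unfolding ab(1,2) mult[OF ab(3)] mult[OF ab(4)] by simp
  next
    fix x assume "x \<in> ?D \<times> {\<one>\<^bsub>S4\<^esub>}"
    then obtain a where a: "x = (a, \<one>\<^bsub>S4\<^esub>)" "a \<in> ?D" by auto
    obtain l where l: "a = pclass (diag4 l)" "invertible (diag4 l)" "\<And>i. l i ^ 3 = l 4 ^ 3"
      using a(2) unfolding D3_eq by (auto simp: invertible_diag4)
    have "l 4 \<noteq> 0" using l(2) by (simp add: invertible_diag4)
    have "a \<otimes>\<^bsub>PGL4\<^esub> a \<otimes>\<^bsub>PGL4\<^esub> a = pclass (diag4 (\<lambda>i. l 4 ^ 3))"
    proof -
      have "a \<otimes>\<^bsub>PGL4\<^esub> a \<otimes>\<^bsub>PGL4\<^esub> a = pclass (diag4 l ** diag4 l ** diag4 l)"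
        using l(2) unfolding l(1) by (simp add: pclass_mult invertible_mult)
      also have "diag4 l ** diag4 l ** diag4 l = diag4 (\<lambda>i. l i ^ 3)"
        by (simp add: diag4_mult power3_eq_cube)
      also have "(\<lambda>i. l i ^ 3) = (\<lambda>i. l 4 ^ 3)" using l(3) by blast
      finally show ?thesis .
    qed
    also have "\<dots> = \<one>\<^bsub>PGL4\<^esub>"
      unfolding pclass_one pclass_eq_iff using \<open>l 4 \<noteq> 0\<close>
      by (intro exI[of _ "1 / l 4 ^ 3"]) (simp add: mat_mult_diag4 diag4_one)
    finally show "x \<otimes>\<^bsub>?G\<^esub> x \<otimes>\<^bsub>?G\<^esub> x = \<one>\<^bsub>?G\<^esub>"
      unfolding a(1) mult[OF a(2)] one by simp
  qed
qed

section \<open>Automorphisms of the Fermat cubic surface\<close>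

text \<open>Inclusion-exclusion recovers the symmetric trilinear form from the sum of cubes, up to
  the factor 3! = 6, which is nonzero in characteristic zero.\<close>

lemma polarize_sum_cubes:
  fixes B :: "'a::field_char_0^'n^'n"
  assumes "\<And>v. (\<Sum>i\<in>UNIV. (B *v v) $ i ^ 3) = c * (\<Sum>i\<in>UNIV. v $ i ^ 3)"
  shows "(\<Sum>i\<in>UNIV. (B *v u) $ i * (B *v v) $ i * (B *v w) $ i) = c * (\<Sum>i\<in>UNIV. u $ i * v $ i * w $ i)"
proof -
  have pol: "6 * (\<Sum>i\<in>UNIV. x $ i * y $ i * z $ i) = (\<Sum>i\<in>UNIV. (x + y + z) $ i ^ 3)
      - (\<Sum>i\<in>UNIV. (x + y) $ i ^ 3) - (\<Sum>i\<in>UNIV. (x + z) $ i ^ 3) - (\<Sum>i\<in>UNIV. (y + z) $ i ^ 3)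
      + (\<Sum>i\<in>UNIV. x $ i ^ 3) + (\<Sum>i\<in>UNIV. y $ i ^ 3) + (\<Sum>i\<in>UNIV. z $ i ^ 3)" for x y z :: "'a^'n"
    unfolding sum_distrib_left sum_subtractf[symmetric] sum.distrib[symmetric]
    by (rule sum.cong) (simp_all add: power3_eq_cube algebra_simps)
  have "6 * (\<Sum>i\<in>UNIV. (B *v u) $ i * (B *v v) $ i * (B *v w) $ i)
      = c * (6 * (\<Sum>i\<in>UNIV. u $ i * v $ i * w $ i))"
    unfolding pol matrix_vector_right_distrib[symmetric] assms by (simp only: algebra_simps)
  then show ?thesis by simp
qed

text \<open>With the inverse \<open>A\<close> of \<open>B\<close>, the polarized identity says that the diagonal matrix formed by
  a column of \<open>B\<close> is a multiple of the outer square of a row of \<open>A\<close>. So it has rank at most 1, and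
  every column of \<open>B\<close> has a single nonzero entry.\<close>

lemma fermat_automorphism_monomial:
  fixes B :: "'a::field_char_0^4^4"
  assumes B: "invertible B" and c: "c \<noteq> 0"
    and inv: "\<And>v. (\<Sum>i\<in>UNIV. (B *v v) $ i ^ 3) = c * (\<Sum>i\<in>UNIV. v $ i ^ 3)"
  shows "\<exists>D \<sigma>. D \<in> D3 \<and> \<sigma> \<in> carrier S4 \<and> B = D ** perm_mat \<sigma>"
proof -
  note tri = polarize_sum_cubes[OF inv]
  have col: "(B *v axis l 1) $ i = B $ i $ l" for i l
    by (simp add: matrix_vector_mult_def axis_def if_distrib cong: if_cong)
  have one_entry: "i = m" if "B $ i $ l \<noteq> 0" "B $ m $ l \<noteq> 0" for i m l
  proof (rule ccontr)
    assume im: "i \<noteq> m"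
    \<comment> \<open>Row \<open>l\<close> of the inverse of \<open>B\<close>.\<close>
    define a where "a i = (matrix_inv B *v axis i 1) $ l" for i
    \<comment> \<open>The polarized identity at a basis vector and at the preimages of two basis
      vectors.\<close>
    have *: "(if i = m then B $ i $ l else 0) = c * (a i * a m)" for i m
    proof -
      have "c * (a i * a m) = (\<Sum>k\<in>UNIV. B $ k $ l * (axis i 1 :: 'a^4) $ k * (axis m 1 :: 'a^4) $ k)"
        using tri[of "axis l 1" "matrix_inv B *v axis i 1" "matrix_inv B *v axis m 1"]
        by (simp add: matrix_inv_vec_right[OF B] col a_def) (simp add: axis_def if_zero_mult)
      also have "\<dots> = (\<Sum>k\<in>UNIV. if k = i then (if i = m then B $ i $ l else 0) else 0)"
        by (rule sum.cong) (auto simp: axis_def)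
      finally show ?thesis by simp
    qed
    from *[of i i] *[of m m] that have "a i \<noteq> 0" "a m \<noteq> 0" by auto
    then show False using *[of i m] im c by simp
  qed
  have "\<exists>i. B $ i $ l \<noteq> 0" for l
  proof (rule ccontr)
    assume "\<not> ?thesis"
    then have "B *v axis l 1 = 0" by (simp add: vec_eq_iff col)
    then have "axis l (1::'a) = 0"
      using matrix_inv_vec_left[OF B, of "axis l 1"] by simp
    then show False by (simp add: axis_eq_0_iff)
  qed
  then obtain \<tau> where \<tau>: "\<And>l. B $ \<tau> l $ l \<noteq> 0" by metis
  have zero: "B $ i $ l = 0" if "i \<noteq> \<tau> l" for i l
    using one_entry[OF _ \<tau>] that by blast
  have "inj \<tau>"
  proof (rule injI, rule ccontr)
    fix l k assume lk: "\<tau> l = \<tau> k" "l \<noteq> k"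
    \<comment> \<open>If columns \<open>l\<close> and \<open>k\<close> had their entries in the same
      row, the left side of the identity would be a nonzero product, while its right side
      vanishes.\<close>
    have "(\<Sum>i\<in>UNIV. (axis l 1 :: 'a^4) $ i * (axis k 1 :: 'a^4) $ i * (axis k 1 :: 'a^4) $ i) = 0"
      using lk(2) by (intro sum.neutral) (auto simp: axis_def)
    then have "(\<Sum>i\<in>UNIV. B $ i $ l * B $ i $ k * B $ i $ k) = 0"
      using tri[of "axis l 1" "axis k 1" "axis k 1"] by (simp add: col)
    moreover have "(\<Sum>i\<in>UNIV. B $ i $ l * B $ i $ k * B $ i $ k)
        = (\<Sum>i\<in>UNIV. if i = \<tau> l then B $ \<tau> l $ l * B $ \<tau> l $ k * B $ \<tau> l $ k else 0)"
      by (rule sum.cong) (auto simp: zero)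
    ultimately show False using \<tau>[of l] \<tau>[of k] lk(1) by simp
  qed
  then have bij: "bij \<tau>" by (simp add: finite_UNIV_inj_surj bij_def)
  then have \<tau>S: "\<tau> \<in> carrier S4" by (simp add: BijGroup_def Bij_def extensional_def)
  define d where "d i = B $ i $ inv_into UNIV \<tau> i" for i
  have inv\<tau>: "\<tau> (inv_into UNIV \<tau> i) = i" for i using bij by (simp add: bij_is_surj surj_f_inv_f)
  have "d i ^ 3 = c" for i
  proof -
    let ?l = "inv_into UNIV \<tau> i"
    have "(\<Sum>k\<in>UNIV. B $ k $ ?l * B $ k $ ?l * B $ k $ ?l) = c"
      \<comment> \<open>With one basis vector in all three places, the identity gives the cube of
        the only nonzero entry in its column.\<close>
      using tri[of "axis ?l 1" "axis ?l 1" "axis ?l 1"] by (simp add: col) (simp add: axis_def if_zero_mult)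
    moreover have "(\<Sum>k\<in>UNIV. B $ k $ ?l * B $ k $ ?l * B $ k $ ?l) = (\<Sum>k\<in>UNIV. if k = i then d i ^ 3 else 0)"
      by (rule sum.cong) (auto simp: zero inv\<tau> d_def power3_eq_cube)
    ultimately show ?thesis by simp
  qed
  moreover have "d i \<noteq> 0" for i using \<tau>[of "inv_into UNIV \<tau> i"] by (simp add: d_def inv\<tau>)
  ultimately have "diag4 d \<in> D3" unfolding D3_eq by auto
  moreover have "B = diag4 d ** perm_mat \<tau>"
  proof -
    have "(diag4 d ** perm_mat \<tau>) $ i $ j = (if j = inv_into UNIV \<tau> i then d i else 0)" for i j
      by (simp add: matrix_matrix_mult_def diag4_def perm_mat_def if_zero_mult)
    moreover have "B $ i $ j = (if j = inv_into UNIV \<tau> i then d i else 0)" for i j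
      using zero[of i j] inv_into_f_f[OF \<open>inj \<tau>\<close>, of j]
      by (cases "i = \<tau> j") (auto simp: d_def)
    ultimately show ?thesis by (simp add: vec_eq_iff)
  qed
  ultimately show ?thesis using \<tau>S by blast
qed

lemma perm_mat_mult_vec: "perm_mat \<sigma> *v v = (\<chi> i. v $ inv_into UNIV \<sigma> i)"
  by (simp add: vec_eq_iff matrix_vector_mult_def perm_mat_def if_zero_mult)

lemma invertible_perm_mat:
  assumes "bij \<sigma>"
  shows "invertible (perm_mat \<sigma> :: 'a::field^4^4)"
proof -
  have "perm_mat (inv_into UNIV \<sigma>) ** perm_mat \<sigma> = (mat 1 :: 'a^4^4)"
    using assms
    by (simp add: vec_eq_iff matrix_matrix_mult_def perm_mat_def mat_def if_zero_mult
        inv_inv_eq bij_is_inj eq_commute)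
  then show ?thesis unfolding invertible_def using matrix_left_right_inverse by blast
qed

lemma Aut4_fermat: "Aut4 (fermat_cubic :: 'a::field_char_0 poly4) = D3_S4_in_PGL4"
proof (intro equalityI subsetI)
  fix x :: "('a^4^4) set" assume "x \<in> Aut4 fermat_cubic"
  then obtain B c where "x = pclass B" "invertible B" "c \<noteq> 0"
    "\<And>v. (\<Sum>i\<in>UNIV. (B *v v) $ i ^ 3) = c * (\<Sum>i\<in>UNIV. v $ i ^ 3)"
    unfolding Aut4_eq semi_invariant4_def eval4_fermat by blast
  with fermat_automorphism_monomial[of B c] show "x \<in> D3_S4_in_PGL4"
    unfolding D3_S4_in_PGL4_def by blast
next
  fix x :: "('a^4^4) set" assume "x \<in> D3_S4_in_PGL4"
  then obtain l \<sigma> where l: "x = pclass (diag4 l ** perm_mat \<sigma>)" "\<And>i. l i \<noteq> 0" "\<And>i. l i ^ 3 = l 4 ^ 3"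
    and "\<sigma> \<in> carrier S4"
    unfolding D3_S4_in_PGL4_def D3_eq by blast
  then have \<sigma>: "bij \<sigma>" by (simp add: BijGroup_def Bij_def)
  define c where "c = l 4 ^ 3"
  have cube: "l i ^ 3 = c" for i unfolding c_def by (rule l(3))
  have c0: "c \<noteq> 0" using l(2)[of 4] by (simp add: c_def)
  have "eval4 fermat_cubic ((diag4 l ** perm_mat \<sigma>) *v v) = c * eval4 fermat_cubic v" for v
  proof -
    have "eval4 fermat_cubic ((diag4 l ** perm_mat \<sigma>) *v v) = c * (\<Sum>i\<in>UNIV. v $ inv_into UNIV \<sigma> i ^ 3)"
      unfolding eval4_fermat sum_distrib_left matrix_vector_mul_assoc[symmetric]
      by (rule sum.cong) (simp_all add: diag4_mult_vec perm_mat_mult_vec power_mult_distrib cube)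
    also have "(\<Sum>i\<in>UNIV. v $ inv_into UNIV \<sigma> i ^ 3) = (\<Sum>i\<in>UNIV. v $ i ^ 3)"
      by (rule sum.reindex_bij_betw) (rule bij_imp_bij_inv[OF \<sigma>])
    finally show ?thesis by (simp add: eval4_fermat)
  qed
  then have "semi_invariant4 fermat_cubic (diag4 l ** perm_mat \<sigma>)"
    unfolding semi_invariant4_def using c0 by (intro exI[of _ c]) simp
  moreover have "invertible (diag4 l ** perm_mat \<sigma>)"
    using l(2) \<sigma> by (simp add: invertible_mult invertible_diag4 invertible_perm_mat)
  ultimately show "x \<in> Aut4 fermat_cubic"
    unfolding Aut4_eq l(1) by blast
qed

text \<open>Conjugation by the matrix of the equivalence carries semi-invariance of \<open>f\<close>
  to that of \<open>g\<close> with the same factor, because the constant relating the two forms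
  cancels.\<close>

lemma proj_equivalent_imp_conjugate_Aut4:
  fixes f g :: "'a::field_char_0 poly4"
  assumes "proj_equivalent f g"
  shows "conjugate_in PGL4 (Aut4 f) (Aut4 g)"
proof -
  obtain A c where A: "invertible A" "c \<noteq> 0" "\<And>v. eval4 g v = c * eval4 f (matrix_inv A *v v)"
    using assms unfolding proj_equivalent_def sim4_iff_eval4 eval4_act4 by blast
  let ?A' = "matrix_inv A"
  note A' = invertible_matrix_inv[OF A(1)]
  let ?conj = "\<lambda>h. pclass A \<otimes>\<^bsub>PGL4\<^esub> h \<otimes>\<^bsub>PGL4\<^esub> inv\<^bsub>PGL4\<^esub> pclass A"
  have conj: "?conj (pclass B) = pclass (A ** B ** ?A')" if "invertible B" for B
    using that A(1) A' by (simp add: pclass_inv pclass_mult invertible_mult)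
  have iff: "semi_invariant4 g (A ** B ** ?A') \<longleftrightarrow> semi_invariant4 f B" for B
  proof -
    have "(\<forall>v. eval4 g ((A ** B ** ?A') *v v) = a * eval4 g v) \<longleftrightarrow> (\<forall>v. eval4 f (B *v v) = a * eval4 f v)" for a
    proof -
      have "eval4 g ((A ** B ** ?A') *v v) = a * eval4 g v \<longleftrightarrow>
          eval4 f (B *v (?A' *v v)) = a * eval4 f (?A' *v v)" for v
        using A(2) by (simp add: A(3) matrix_inv_vec_left[OF A(1)] flip: matrix_vector_mul_assoc)
      then show ?thesis by (metis matrix_inv_vec_left[OF A(1)])
    qed
    then show ?thesis unfolding semi_invariant4_def by simp
  qed
  have "Aut4 g = ?conj ` Aut4 f"
  proof (intro equalityI subsetI)
    fix x assume "x \<in> Aut4 g"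
    then obtain C where C: "x = pclass C" "invertible C" "semi_invariant4 g C"
      unfolding Aut4_eq by blast
    define B where "B = ?A' ** C ** A"
    have "A ** B ** ?A' = (A ** ?A') ** C ** (A ** ?A')"
      by (simp only: B_def matrix_mul_assoc)
    then have BC: "A ** B ** ?A' = C" by (simp add: matrix_inv_right A(1))
    have "invertible B" using A(1) A' C(2) by (simp add: B_def invertible_mult)
    moreover have "semi_invariant4 f B" using C(3) iff[of B] BC by simp
    ultimately show "x \<in> ?conj ` Aut4 f"
      unfolding Aut4_eq C(1) using conj[of B] BC by blast
  next
    fix x assume "x \<in> ?conj ` Aut4 f"
    then obtain B where B: "x = ?conj (pclass B)" "invertible B" "semi_invariant4 f B"
      unfolding Aut4_eq by blast
    have "x = pclass (A ** B ** ?A')" unfolding B(1) by (rule conj[OF B(2)])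
    moreover have "invertible (A ** B ** ?A')" using A(1) A' B(2) by (simp add: invertible_mult)
    ultimately show "x \<in> Aut4 g" unfolding Aut4_eq using iff[of B] B(3) by blast
  qed
  then show ?thesis
    unfolding conjugate_in_def using A(1) by (intro bexI[of _ "pclass A"]) (auto simp: carrier_PGL4)
qed

theorem lemma2p3:
  fixes f :: "'a::{alg_closed_field, field_char_0} poly4"
  assumes "nonsingular_cubic_surface f"
  shows "(group_invariant Z3_cubed f \<longrightarrow> proj_equivalent f fermat_cubic) \<and>
         (group_invariant (D3_semidirect_S4 :: (('a^4^4) set \<times> (4 \<Rightarrow> 4)) monoid) f \<longrightarrow>
            proj_equivalent f fermat_cubic \<and>
            conjugate_in PGL4 (Aut4 f) D3_S4_in_PGL4)"
  using Z3_cubed_invariant_imp_fermat[OF assms] D3_semidirect_S4_invariant_imp_fermat[OF assms]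
    proj_equivalent_imp_conjugate_Aut4[of f fermat_cubic]
  unfolding Aut4_fermat by blast

end
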